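(* Let $U\subseteq\mathbb{R}^d\times(0,\infty)$ be open and let $\tilde u:\mathbb{R}^d\times(0,\infty)\to\mathbb{R}$. If $\tilde u$ is a subsolution (resp. supersolution) in irrational directions in $U$ of $$\overline{m}(\widehat{Du})\,u_t-\mathrm{tr}\big((\mathrm{Id}-\widehat{Du}\otimes\widehat{Du})D^2u\big)=0,$$ then $\tilde u$ is a viscosity subsolution (resp. supersolution) of this equation in $U$ in the usual sense.
   Context: Notation: $\mathbb{T}^d=\mathbb{R}^d/\mathbb{Z}^d$; $\hat p=\|p\|^{-1}p$ for $p\in\mathbb{R}^d\setminus\{0\}$; $\mathbb{R}\mathbb{Z}^d=\{\lambda k:\lambda\in\mathbb{R},k\in\mathbb{Z}^d\}$; $D,D^2$ are spatial derivatives. Effective mobility: $\overline m:S^{d-1}\to[\theta,\Theta]$, $\overline m(e)=c_W^{-1}\int_{\mathbb{R}\times\mathbb{T}^d}m(y,\dot q(s)e)\dot q(s)^2\,dy\,ds$, $c_W=\int_{\mathbb{R}}\dot q(s)^2ds$. Here $m\in C(\mathbb{T}^d\times\mathbb{R}^d)$ with $0<\theta:=\min m$, $\Theta:=\max m<\infty$, and $\sup\{|m(y,v)-m(y',v)|/\|y-y'\|:y\neq y' \in \mathbb{T}^d, v \in \mathbb{R}^d\}<\infty$; $W\in C^3([-1,1])$, $W\ge0$, $\{W=0\}=\{-1,1\}$, $\{W'=0\}=\{-1,0,1\}$, $W'>0$ on $(-1,0)$, $W'<0$ on $(0,1)$, $W''(\pm1)>0$, $W''(0)<0$; and $q:\mathbb{R}\to(-1,1)$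 is the unique strictly increasing solution of $\ddot q=W'(q)$ with $q(\pm\infty)=\pm1$, $q(0)=0$. Subsolution in irrational directions in $U$: a locally bounded upper semicontinuous $\tilde u:\mathbb{R}^d\times(0,\infty)\to\mathbb{R}$ for which there is $K>0$ such that, for every smooth $\varphi:\mathbb{R}^d\times(0,\infty)\to\mathbb{R}$ such that $\tilde u-\varphi$ has a strict local maximum at $(x_0,t_0)\in U$, the following hold (all derivatives at $(x_0,t_0)$): (a) if $D\varphi\in\mathbb{R}^d\setminus\mathbb{R}\mathbb{Z}^d$, then $\overline m(\widehat{D\varphi})\varphi_t-\mathrm{tr}((\mathrm{Id}-\widehat{D\varphi}\otimes\widehat{D\varphi})D^2\varphi)\le0$; (b) for every $\delta>0$, if $D\varphi\in\mathbb{R}\mathbb{Z}^d\setminus\{0\}$ and $\|(\mathrm{Id}-\widehat{D\varphi}\otimes\widehat{D\varphi})D^2\varphi\|\le\delta\|D\varphi\|$, then $\varphi_t\le K\delta\|D\varphi\|$; (c) if $\|D\varphi\|=\|D^2\varphi\|=0$, then $\varphi_t\le0$. Supersolution in irrational directions: locally bounded lower semicontinuous, with strict local minima in place of strict local maxima and conclusions reversed: in (a) "$\ge0$", in (b) "$\varphi_t\ge-K\delta\|D\varphi\|$", in (c) "$\varphi_t\ge0$". Viscosity subsolution in the usual sense in $U$: a locally bounded upper semicontinuous $\tilde u$ such that, whenever $\varphi$ is smooth and $\tilde u-\varphi$ has a strict local maximum at $(x_0,t_0)\in U$: if $D\varphi(x_0,t_0)\ne0$ then $\overline m(\widehat{D\varphi})\varphi_t-\mathrm{tr}((\mathrm{Id}-\widehat{D\varphi}\otimes\widehat{D\varphi})D^2\varphi)\le0$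 at $(x_0,t_0)$; if $\|D\varphi(x_0,t_0)\|=\|D^2\varphi(x_0,t_0)\|=0$ then $\varphi_t(x_0,t_0)\le0$. Supersolutions: locally bounded lower semicontinuous, strict local minima, reversed inequalities. *)

theory Defs
  imports "HOL-Analysis.Analysis"
begin

section \<open>Lattice, torus and mobility\<close>

definition int_lattice :: "(real^'n) set" where
  "int_lattice = {k. \<forall>i. k $ i \<in> \<int>}"

definition rational_directions :: "(real^'n) set" where
  "rational_directions = {c *\<^sub>R k | c k. k \<in> int_lattice}"

text \<open>Functions on the torus \<open>\<real>\<^sup>d / \<int>\<^sup>d\<close> are represented by lattice-periodic functions on
  \<open>\<real>\<^sup>d\<close>; the distance is the quotient distance, and two points are distinct in the
  torus iff their difference is not in the lattice.\<close>

definition torus_dist :: "real^'n \<Rightarrow> real^'n \<Rightarrow> real" where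
  "torus_dist y y' = infdist (y - y') int_lattice"

text \<open>The minimum and maximum of \<open>m\<close> over the non-compact space are read as infimum and supremum;
  boundedness of the range makes both genuine.\<close>

definition admissible_mobility :: "(real^'n \<Rightarrow> real^'n \<Rightarrow> real) \<Rightarrow> bool" where
  "admissible_mobility m \<longleftrightarrow>
     (\<forall>y v. \<forall>k\<in>int_lattice. m (y + k) v = m y v) \<and>
     continuous_on UNIV (\<lambda>(y, v). m y v) \<and>
     bounded (range (\<lambda>(y, v). m y v)) \<and>
     0 < Inf (range (\<lambda>(y, v). m y v)) \<and>
     bdd_above {\<bar>m y v - m y' v\<bar> / torus_dist y y' | y y' v. y - y' \<notin> int_lattice}"

section \<open>Potential, standing wave and effective mobility\<close>

text \<open>\<open>W1\<close>, \<open>W2\<close>, \<open>W3\<close> are the first three derivatives of \<open>W\<close> on the closed interval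
  (one-sided at the endpoints); only the values on \<open>[-1,1]\<close> matter.\<close>

definition double_well ::
  "(real \<Rightarrow> real) \<Rightarrow> (real \<Rightarrow> real) \<Rightarrow> (real \<Rightarrow> real) \<Rightarrow> (real \<Rightarrow> real) \<Rightarrow> bool" where
  "double_well W W1 W2 W3 \<longleftrightarrow>
     (\<forall>x\<in>{-1..1}. (W has_real_derivative W1 x) (at x within {-1..1})) \<and>
     (\<forall>x\<in>{-1..1}. (W1 has_real_derivative W2 x) (at x within {-1..1})) \<and>
     (\<forall>x\<in>{-1..1}. (W2 has_real_derivative W3 x) (at x within {-1..1})) \<and>
     continuous_on {-1..1} W3 \<and>
     (\<forall>x\<in>{-1..1}. 0 \<le> W x) \<and>
     {x\<in>{-1..1}. W x = 0} = {-1, 1} \<and>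
     {x\<in>{-1..1}. W1 x = 0} = {-1, 0, 1} \<and>
     (\<forall>x\<in>{-1<..<0}. 0 < W1 x) \<and>
     (\<forall>x\<in>{0<..<1}. W1 x < 0) \<and>
     0 < W2 (-1) \<and> 0 < W2 1 \<and> W2 0 < 0"

definition standing_wave :: "(real \<Rightarrow> real) \<Rightarrow> (real \<Rightarrow> real) \<Rightarrow> bool" where
  "standing_wave W1 q \<longleftrightarrow>
     range q \<subseteq> {-1<..<1} \<and> strict_mono q \<and>
     (\<forall>s. (q has_real_derivative deriv q s) (at s)) \<and>
     (\<forall>s. (deriv q has_real_derivative W1 (q s)) (at s)) \<and>
     (q \<longlongrightarrow> -1) at_bot \<and> (q \<longlongrightarrow> 1) at_top \<and> q 0 = 0"

definition wave_const :: "(real \<Rightarrow> real) \<Rightarrow> real" where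
  "wave_const q = (LINT s|lborel. (deriv q s)\<^sup>2)"

text \<open>The torus integral is taken over the fundamental domain \<open>[0,1]\<^sup>d\<close>, i.e. \<open>cbox 0 1\<close>.\<close>

definition eff_mobility ::
  "(real^'n \<Rightarrow> real^'n \<Rightarrow> real) \<Rightarrow> (real \<Rightarrow> real) \<Rightarrow> real^'n \<Rightarrow> real" where
  "eff_mobility m q e =
     inverse (wave_const q) *
     (LINT z : UNIV \<times> cbox 0 1 | lborel.
        m (snd z) (deriv q (fst z) *\<^sub>R e) * (deriv q (fst z))\<^sup>2)"

section \<open>Semicontinuity, smoothness and derivatives\<close>

definition usc_on :: "'a::topological_space set \<Rightarrow> ('a \<Rightarrow> real) \<Rightarrow> bool" where
  "usc_on S f \<longleftrightarrow> (\<forall>x\<in>S. \<forall>c > f x. \<forall>\<^sub>F y in at x within S. f y < c)"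

definition lsc_on :: "'a::topological_space set \<Rightarrow> ('a \<Rightarrow> real) \<Rightarrow> bool" where
  "lsc_on S f \<longleftrightarrow> (\<forall>x\<in>S. \<forall>c < f x. \<forall>\<^sub>F y in at x within S. c < f y)"

definition locally_bounded_on :: "'a::metric_space set \<Rightarrow> ('a \<Rightarrow> real) \<Rightarrow> bool" where
  "locally_bounded_on S f \<longleftrightarrow> (\<forall>x\<in>S. \<exists>r>0. bounded (f ` (ball x r \<inter> S)))"

definition strict_local_max_on :: "'a::metric_space set \<Rightarrow> ('a \<Rightarrow> real) \<Rightarrow> 'a \<Rightarrow> bool" where
  "strict_local_max_on S f x \<longleftrightarrow> (\<exists>r>0. \<forall>y\<in>ball x r \<inter> S. y \<noteq> x \<longrightarrow> f y < f x)"

definition strict_local_min_on :: "'a::metric_space set \<Rightarrow> ('a \<Rightarrow> real) \<Rightarrow> 'a \<Rightarrow> bool" where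
  "strict_local_min_on S f x \<longleftrightarrow> (\<exists>r>0. \<forall>y\<in>ball x r \<inter> S. y \<noteq> x \<longrightarrow> f x < f y)"

text \<open>\<open>C\<^sup>k\<close> regularity on an open set \<open>S\<close>; \<open>smooth_fun_on\<close> is \<open>C\<^sup>\<infinity>\<close>.\<close>

primrec Ck_on :: "nat \<Rightarrow> 'a::euclidean_space set \<Rightarrow> ('a \<Rightarrow> real) \<Rightarrow> bool" where
  "Ck_on 0 S f \<longleftrightarrow> continuous_on S f"
| "Ck_on (Suc k) S f \<longleftrightarrow>
     (\<forall>x\<in>S. f differentiable (at x)) \<and>
     (\<forall>v. Ck_on k S (\<lambda>x. frechet_derivative f (at x) v))"

definition smooth_fun_on :: "'a::euclidean_space set \<Rightarrow> ('a \<Rightarrow> real) \<Rightarrow> bool" where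
  "smooth_fun_on S f \<longleftrightarrow> (\<forall>k. Ck_on k S f)"

definition spacetime :: "((real^'n) \<times> real) set" where
  "spacetime = UNIV \<times> {0<..}"

definition time_deriv :: "((real^'n) \<times> real \<Rightarrow> real) \<Rightarrow> (real^'n) \<times> real \<Rightarrow> real" where
  "time_deriv \<phi> z = frechet_derivative \<phi> (at z) (0, 1)"

definition space_grad :: "((real^'n) \<times> real \<Rightarrow> real) \<Rightarrow> (real^'n) \<times> real \<Rightarrow> real^'n" where
  "space_grad \<phi> z = (\<chi> i. frechet_derivative \<phi> (at z) (axis i 1, 0))"

definition space_hess :: "((real^'n) \<times> real \<Rightarrow> real) \<Rightarrow> (real^'n) \<times> real \<Rightarrow> real^'n^'n" where
  "space_hess \<phi> z =
     (\<chi> i j. frechet_derivative (\<lambda>w. space_grad \<phi> w $ i) (at z) (axis j 1, 0))"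

section \<open>The equation and its notions of solution\<close>

definition tensor_vec :: "real^'n \<Rightarrow> real^'n \<Rightarrow> real^'n^'n" where
  "tensor_vec v w = (\<chi> i j. v $ i * w $ j)"

text \<open>\<open>Id - p \<otimes> p\<close> (for the normalised \<open>p\<close>, i.e. \<^term>\<open>sgn p\<close>) applied to the Hessian \<open>X\<close>.\<close>

definition tangential_part :: "real^'n \<Rightarrow> real^'n^'n \<Rightarrow> real^'n^'n" where
  "tangential_part p X = (mat 1 - tensor_vec (sgn p) (sgn p)) ** X"

definition mat_norm :: "real^'n^'n \<Rightarrow> real" where
  "mat_norm A = onorm ((*v) A)"

text \<open>The left-hand side of the equation at \<open>z\<close>, for a mobility \<open>\<mu>\<close> of the direction.\<close>

definition mcf_operator ::
  "(real^'n \<Rightarrow> real) \<Rightarrow> ((real^'n) \<times> real \<Rightarrow> real) \<Rightarrow> (real^'n) \<times> real \<Rightarrow> real" where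
  "mcf_operator \<mu> \<phi> z =
     \<mu> (sgn (space_grad \<phi> z)) * time_deriv \<phi> z
     - trace (tangential_part (space_grad \<phi> z) (space_hess \<phi> z))"

definition irrational_subsolution ::
  "(real^'n \<Rightarrow> real) \<Rightarrow> ((real^'n) \<times> real) set \<Rightarrow> ((real^'n) \<times> real \<Rightarrow> real) \<Rightarrow> bool" where
  "irrational_subsolution \<mu> U u \<longleftrightarrow>
     locally_bounded_on spacetime u \<and> usc_on spacetime u \<and>
     (\<exists>K>0. \<forall>\<phi>. \<forall>z\<in>U.
        smooth_fun_on spacetime \<phi> \<and> strict_local_max_on spacetime (\<lambda>w. u w - \<phi> w) z \<longrightarrow>
        (space_grad \<phi> z \<notin> rational_directions \<longrightarrow> mcf_operator \<mu> \<phi> z \<le> 0) \<and>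
        (\<forall>\<delta>>0. space_grad \<phi> z \<in> rational_directions - {0} \<and>
            mat_norm (tangential_part (space_grad \<phi> z) (space_hess \<phi> z))
              \<le> \<delta> * norm (space_grad \<phi> z) \<longrightarrow>
            time_deriv \<phi> z \<le> K * \<delta> * norm (space_grad \<phi> z)) \<and>
        (norm (space_grad \<phi> z) = 0 \<and> mat_norm (space_hess \<phi> z) = 0 \<longrightarrow> time_deriv \<phi> z \<le> 0))"

definition irrational_supersolution ::
  "(real^'n \<Rightarrow> real) \<Rightarrow> ((real^'n) \<times> real) set \<Rightarrow> ((real^'n) \<times> real \<Rightarrow> real) \<Rightarrow> bool" where
  "irrational_supersolution \<mu> U u \<longleftrightarrow>
     locally_bounded_on spacetime u \<and> lsc_on spacetime u \<and>
     (\<exists>K>0. \<forall>\<phi>. \<forall>z\<in>U.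
        smooth_fun_on spacetime \<phi> \<and> strict_local_min_on spacetime (\<lambda>w. u w - \<phi> w) z \<longrightarrow>
        (space_grad \<phi> z \<notin> rational_directions \<longrightarrow> mcf_operator \<mu> \<phi> z \<ge> 0) \<and>
        (\<forall>\<delta>>0. space_grad \<phi> z \<in> rational_directions - {0} \<and>
            mat_norm (tangential_part (space_grad \<phi> z) (space_hess \<phi> z))
              \<le> \<delta> * norm (space_grad \<phi> z) \<longrightarrow>
            time_deriv \<phi> z \<ge> - K * \<delta> * norm (space_grad \<phi> z)) \<and>
        (norm (space_grad \<phi> z) = 0 \<and> mat_norm (space_hess \<phi> z) = 0 \<longrightarrow> time_deriv \<phi> z \<ge> 0))"

definition viscosity_subsolution ::
  "(real^'n \<Rightarrow> real) \<Rightarrow> ((real^'n) \<times> real) set \<Rightarrow> ((real^'n) \<times> real \<Rightarrow> real) \<Rightarrow> bool" where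
  "viscosity_subsolution \<mu> U u \<longleftrightarrow>
     locally_bounded_on spacetime u \<and> usc_on spacetime u \<and>
     (\<forall>\<phi>. \<forall>z\<in>U.
        smooth_fun_on spacetime \<phi> \<and> strict_local_max_on spacetime (\<lambda>w. u w - \<phi> w) z \<longrightarrow>
        (space_grad \<phi> z \<noteq> 0 \<longrightarrow> mcf_operator \<mu> \<phi> z \<le> 0) \<and>
        (norm (space_grad \<phi> z) = 0 \<and> mat_norm (space_hess \<phi> z) = 0 \<longrightarrow> time_deriv \<phi> z \<le> 0))"

definition viscosity_supersolution ::
  "(real^'n \<Rightarrow> real) \<Rightarrow> ((real^'n) \<times> real) set \<Rightarrow> ((real^'n) \<times> real \<Rightarrow> real) \<Rightarrow> bool" where
  "viscosity_supersolution \<mu> U u \<longleftrightarrow>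
     locally_bounded_on spacetime u \<and> lsc_on spacetime u \<and>
     (\<forall>\<phi>. \<forall>z\<in>U.
        smooth_fun_on spacetime \<phi> \<and> strict_local_min_on spacetime (\<lambda>w. u w - \<phi> w) z \<longrightarrow>
        (space_grad \<phi> z \<noteq> 0 \<longrightarrow> mcf_operator \<mu> \<phi> z \<ge> 0) \<and>
        (norm (space_grad \<phi> z) = 0 \<and> mat_norm (space_hess \<phi> z) = 0 \<longrightarrow> time_deriv \<phi> z \<ge> 0))"

end

theory Submission
  imports Defs
begin

text \<open>
  Both notions agree on test functions with irrational or vanishing gradient, so the equation has to
  be recovered at a point \<open>z0\<close> where \<open>u - \<phi>\<close> has a strict local maximum and \<open>p = D\<phi>(z0) \<noteq> 0\<close> is
  rational. The mobility \<open>\<mu>\<close> enters through its continuity and nonnegativity.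

  \<^emph>\<open>Normal form.\<close> Write \<open>b = \<phi>\<^sub>t\<close>. Up to an arbitrarily small increase of the trace, \<open>\<phi>\<close> may be replaced
  near \<open>z0 = (x0, t0)\<close> by a majorant \<open>\<phi>(z0) + F(A)\<close> with \<open>F(s) = s + C s\<^sup>2\<close> and
  \<open>A(x, t) = p \<bullet> (x - x0) + (x - x0) \<bullet> Y (x - x0) / 2 + b (t - t0) + D (t - t0)\<^sup>2\<close>, where \<open>Y\<close> is symmetric,
  maps into the orthogonal complement of \<open>p\<close>, and has the trace of the tangential Hessian
  (\<open>paraboloid_majorant\<close>). All second derivatives involving the direction \<open>p\<close> or time are absorbed by
  large \<open>C\<close> and \<open>D\<close>. Since \<open>F\<close> is increasing near 0, touching \<open>u\<close> by \<open>F(A)\<close> (with \<open>u(z0) = 0\<close>, say) is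
  the same as touching \<open>f(u)\<close> by \<open>A\<close>, where \<open>f\<close> is the inverse of \<open>F\<close>; and the gradient of \<open>F(A)\<close> has the direction of the
  gradient \<open>p + Y (x - x0)\<close> of \<open>A\<close>, exactly.

  \<^emph>\<open>Translation.\<close> Suppose \<open>\<mu>(p/|p|) b > tr Y\<close>. Translate the quadratic form in space: for \<open>a\<close> near \<open>x0\<close>
  replace \<open>x - x0\<close> by \<open>x - a\<close> in the quadratic term and let \<open>(x\<^sub>a, t\<^sub>a)\<close> be a contact point of the
  translated paraboloid. All data at the contact point are close to those at \<open>z0\<close>, so if the contact
  gradient \<open>p + Y (x\<^sub>a - a)\<close> were irrational, the irrational subsolution inequality would be violated.
  Hence every contact gradient is rational. Because \<open>Y (x\<^sub>a - a)\<close> is orthogonal to \<open>p\<close>, each lattice line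
  contains at most one such gradient, so \<open>Y (x\<^sub>a - a)\<close> takes only countably many values, and by Baire
  category it equals a constant \<open>c\<close> for all \<open>a\<close> in some ball.

  \<^emph>\<open>Flatness.\<close> On that ball the maximal value \<open>G(a)\<close> satisfies
  \<open>|G(a') - G(a) - c \<bullet> (a' - a)| \<le> (a' - a) \<bullet> Y (a' - a) / 2\<close>. Therefore \<open>Y\<close> is positive semidefinite and
  \<open>G\<close> is affine, which means that the lower envelope of the touching paraboloids is itself affine in space: at a
  contact point, \<open>f(u)\<close> is touched from above by a function affine in space with rational gradient \<open>p + c\<close>
  (\<open>flat_contact\<close>). Its tangential Hessian vanishes, so the rational-direction condition applies with
  every \<open>\<delta> > 0\<close> and forces the time derivative, which is close to \<open>b\<close>, to be nonpositive. But
  \<open>\<mu>(p/|p|) b > tr Y \<ge> 0\<close> gives \<open>b > 0\<close>, a contradiction (\<open>touching_bound\<close>).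

  Supersolutions reduce to subsolutions by passing to \<open>- u\<close> and the reflected mobility \<open>\<mu>(- e)\<close>.
\<close>

section \<open>Contact points of translated paraboloids\<close>

definition half_form :: "real^'n^'n \<Rightarrow> real^'n \<Rightarrow> real" where
  "half_form Y v = (v \<bullet> (Y *v v)) / 2"

lemma symmetric_form:
  fixes Y :: "real^'n^'n"
  assumes "transpose Y = Y"
  shows "x \<bullet> (Y *v y) = y \<bullet> (Y *v x)"
  by (metis assms dot_lmul_matrix inner_commute transpose_matrix_vector)

lemma half_form_add:
  fixes Y :: "real^'n^'n"
  assumes "transpose Y = Y"
  shows "half_form Y (v + d) = half_form Y v + (Y *v v) \<bullet> d + half_form Y d"
  using symmetric_form[OF assms, of v d]
  by (simp add: half_form_def matrix_vector_right_distrib inner_add_left inner_add_right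
      inner_commute[of "Y *v v" d] field_simps)

lemma half_form_scaleR: "half_form Y (c *\<^sub>R v) = c\<^sup>2 * half_form Y v"
  by (simp add: half_form_def matrix_vector_mult_scaleR power2_eq_square)

lemma half_form_minus: "half_form Y (- v) = half_form Y v"
  using half_form_scaleR[of Y "-1" v] by simp

lemma half_form_0 [simp]: "half_form Y 0 = 0"
  by (simp add: half_form_def)

lemma continuous_on_half_form [continuous_intros]:
  "continuous_on S f \<Longrightarrow> continuous_on S (\<lambda>x. half_form Y (f x))"
  unfolding half_form_def
  by (intro continuous_intros bounded_linear.continuous_on[OF matrix_vector_mul_bounded_linear]) auto

lemma tendsto_half_form [tendsto_intros]:
  "(f \<longlongrightarrow> l) F \<Longrightarrow> ((\<lambda>x. half_form Y (f x)) \<longlongrightarrow> half_form Y l) F"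
  unfolding half_form_def
  by (intro tendsto_intros bounded_linear.tendsto[OF matrix_vector_mul_bounded_linear]) auto

lemma abs_half_form_le: "\<bar>half_form Y v\<bar> \<le> onorm ((*v) Y) * (norm v)\<^sup>2"
proof -
  have "\<bar>v \<bullet> (Y *v v)\<bar> \<le> norm v * norm (Y *v v)"
    by (rule Cauchy_Schwarz_ineq2)
  also have "\<dots> \<le> norm v * (onorm ((*v) Y) * norm v)"
    by (intro mult_left_mono onorm matrix_vector_mul_bounded_linear) auto
  finally have *: "\<bar>v \<bullet> (Y *v v)\<bar> \<le> onorm ((*v) Y) * (norm v)\<^sup>2"
    by (metis (no_types) mult.assoc mult.commute power2_eq_square)
  have "\<bar>half_form Y v\<bar> \<le> \<bar>v \<bullet> (Y *v v)\<bar>"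
    by (simp add: half_form_def)
  with * show ?thesis by linarith
qed

lemma usc_on_sequentially:
  assumes "usc_on S f" "x \<in> S" "\<And>n. X n \<in> S" "X \<longlonglongrightarrow> x" "f x < c"
  shows "\<forall>\<^sub>F n in sequentially. f (X n) < c"
proof -
  have "\<forall>\<^sub>F y in at x within S. f y < c"
    using assms(1,2,5) by (auto simp: usc_on_def)
  then obtain T where "open T" "x \<in> T" and T: "\<And>y. y \<in> T \<Longrightarrow> y \<noteq> x \<Longrightarrow> y \<in> S \<Longrightarrow> f y < c"
    by (auto simp: eventually_at_topological)
  then have "\<forall>\<^sub>F n in sequentially. X n \<in> T"
    using assms(4) by (auto simp: tendsto_def)
  then show ?thesis
    by (rule eventually_mono) (use T assms(3,5) in blast)
qed

lemma usc_on_attains_max: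
  assumes "compact S" "S \<noteq> {}" "usc_on S f"
  shows "\<exists>x\<in>S. \<forall>y\<in>S. f y \<le> f x"
proof (rule ccontr)
  assume "\<not> ?thesis"
  then have *: "\<forall>x\<in>S. \<exists>y\<in>S. f x < f y" by (meson not_le)
  have "\<exists>T. open T \<and> x \<in> T \<and> (\<exists>y\<in>S. \<forall>w\<in>T \<inter> S. f w < f y)" if "x \<in> S" for x
  proof -
    obtain y where y: "y \<in> S" "f x < f y" using * \<open>x \<in> S\<close> by blast
    then have "\<forall>\<^sub>F w in at x within S. f w < f y"
      using assms(3) \<open>x \<in> S\<close> by (auto simp: usc_on_def)
    then show ?thesis
      using y by (force simp: eventually_at_topological)
  qed
  then obtain T y where T: "\<And>x. x \<in> S \<Longrightarrow> open (T x) \<and> x \<in> T x \<and> y x \<in> S \<and> (\<forall>w\<in>T x \<inter> S. f w < f (y x))"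
    by metis
  obtain I where I: "I \<subseteq> S" "finite I" "S \<subseteq> (\<Union>x\<in>I. T x)"
    using compactE_image[OF \<open>compact S\<close>, of S T] T by blast
  then have "I \<noteq> {}" using \<open>S \<noteq> {}\<close> by auto
  then have "Max ((\<lambda>x. f (y x)) ` I) \<in> (\<lambda>x. f (y x)) ` I"
    using \<open>finite I\<close> by (intro Max_in) auto
  then obtain i where i: "i \<in> I" "Max ((\<lambda>x. f (y x)) ` I) = f (y i)" by blast
  have "y i \<in> S" using T I(1) i(1) by blast
  then obtain j where j: "j \<in> I" "y i \<in> T j" using I(3) by blast
  then have "f (y i) < f (y j)" using T I(1) \<open>y i \<in> S\<close> by blast
  moreover have "f (y j) \<le> Max ((\<lambda>x. f (y x)) ` I)" using j(1) I(2) by (intro Max_ge) auto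
  ultimately show False using i by simp
qed

lemma usc_on_add_continuous:
  assumes "usc_on S f" "continuous_on S (g :: _ \<Rightarrow> real)"
  shows "usc_on S (\<lambda>x. f x + g x)"
  unfolding usc_on_def
proof (intro ballI allI impI)
  fix x c assume x: "x \<in> S" "f x + g x < c"
  define e where "e = (c - (f x + g x)) / 2"
  have e: "e > 0" using x by (simp add: e_def)
  have 1: "\<forall>\<^sub>F y in at x within S. f y < f x + e"
    using assms(1) x(1) e by (auto simp: usc_on_def)
  have "(g \<longlongrightarrow> g x) (at x within S)" using assms(2) x(1) by (auto simp: continuous_on_def)
  then have 2: "\<forall>\<^sub>F y in at x within S. g y < g x + e"
    using e by (intro order_tendstoD) auto
  show "\<forall>\<^sub>F y in at x within S. f y + g y < c"
    using 1 2 by eventually_elim (auto simp: e_def field_simps)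
qed

text \<open>A contact point of the paraboloid with quadratic part \<open>Y\<close> translated in space by \<open>a\<close>: the affine part and
  the dependence on time do not move with \<open>a\<close> and belong to \<open>h\<close>.\<close>

definition contact ::
  "((real^'n) \<times> real) set \<Rightarrow> ((real^'n) \<times> real \<Rightarrow> real) \<Rightarrow> real^'n^'n \<Rightarrow> real^'n \<Rightarrow> (real^'n) \<times> real \<Rightarrow> bool" where
  "contact Z h Y a z \<longleftrightarrow>
     z \<in> Z \<and> (\<forall>w\<in>Z. h w - half_form Y (fst w - a) \<le> h z - half_form Y (fst z - a))"

lemma contact_exists:
  assumes "compact Z" "Z \<noteq> {}" "usc_on Z h"
  shows "\<exists>z. contact Z h Y a z"
proof -
  have "usc_on Z (\<lambda>w. h w + (- half_form Y (fst w - a)))"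
    by (intro usc_on_add_continuous assms continuous_intros)
  from usc_on_attains_max[OF assms(1,2) this] show ?thesis
    by (metis contact_def diff_conv_add_uminus)
qed

text \<open>An upper semicontinuous function may only jump upwards in the limit, and a contact point wants \<open>h\<close> to be
  large there; so contact points pass to limits although \<open>h\<close> is not continuous.\<close>

lemma contact_limit:
  assumes "closed Z" "usc_on Z h" "A \<longlonglongrightarrow> a" "X \<longlonglongrightarrow> z" "\<And>n. contact Z h Y (A n) (X n)"
  shows "contact Z h Y a z"
proof -
  have XZ: "X n \<in> Z" for n using assms(5) by (auto simp: contact_def)
  then have z: "z \<in> Z" using assms(1,4) by (metis closed_sequentially)
  moreover have "h w - half_form Y (fst w - a) \<le> h z - half_form Y (fst z - a)" if "w \<in> Z" for w
  proof (rule field_le_epsilon)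
    fix e :: real assume "0 < e"
    have "\<forall>\<^sub>F n in sequentially. h (X n) < h z + e"
      using \<open>0 < e\<close> by (intro usc_on_sequentially[OF assms(2) z XZ assms(4)]) auto
    then have "\<forall>\<^sub>F n in sequentially. h w - half_form Y (fst w - A n) \<le> h z + e - half_form Y (fst (X n) - A n)"
    proof (rule eventually_mono)
      fix n assume "h (X n) < h z + e"
      moreover have "h w - half_form Y (fst w - A n) \<le> h (X n) - half_form Y (fst (X n) - A n)"
        using assms(5)[of n] that by (auto simp: contact_def)
      ultimately show "h w - half_form Y (fst w - A n) \<le> h z + e - half_form Y (fst (X n) - A n)"
        by linarith
    qed
    moreover have "(\<lambda>n. h w - half_form Y (fst w - A n)) \<longlonglongrightarrow> h w - half_form Y (fst w - a)"
      by (intro tendsto_intros assms)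
    moreover have "(\<lambda>n. h z + e - half_form Y (fst (X n) - A n)) \<longlonglongrightarrow> h z + e - half_form Y (fst z - a)"
      by (intro tendsto_intros assms)
    ultimately have "h w - half_form Y (fst w - a) \<le> h z + e - half_form Y (fst z - a)"
      using tendsto_le sequentially_bot by blast
    then show "h w - half_form Y (fst w - a) \<le> h z - half_form Y (fst z - a) + e" by linarith
  qed
  ultimately show ?thesis by (simp add: contact_def)
qed

text \<open>If the contact point is unique for one translation, compactness keeps all contact points of nearby
  translations close to it.\<close>

lemma contact_near:
  assumes "compact Z" "usc_on Z h" "\<And>z. contact Z h Y a z \<Longrightarrow> z = z0" "r > 0"
  shows "\<exists>\<rho>>0. \<forall>b z. dist b a < \<rho> \<and> contact Z h Y b z \<longrightarrow> dist z z0 < r"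
proof (rule ccontr)
  assume "\<not> ?thesis"
  then have *: "\<exists>b z. dist b a < \<rho> \<and> contact Z h Y b z \<and> r \<le> dist z z0" if "\<rho> > 0" for \<rho>
    using that by force
  have "\<forall>n. \<exists>b z. dist b a < inverse (Suc n) \<and> contact Z h Y b z \<and> r \<le> dist z z0"
    by (intro allI *) simp
  then obtain B X where B: "\<And>n. dist (B n) a < inverse (Suc n)"
    and X: "\<And>n. contact Z h Y (B n) (X n)" "\<And>n. r \<le> dist (X n) z0"
    by metis
  have "B \<longlonglongrightarrow> a"
  proof (rule metric_tendsto_imp_tendsto[OF LIMSEQ_inverse_real_of_nat])
    show "\<forall>\<^sub>F n in sequentially. dist (B n) a \<le> dist (inverse (real (Suc n))) 0"
      using less_imp_le[OF B] by simp
  qed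
  have "\<And>n. X n \<in> Z" using X by (auto simp: contact_def)
  then obtain z s where s: "strict_mono s" "(X \<circ> s) \<longlonglongrightarrow> z"
    using \<open>compact Z\<close> unfolding compact_def by meson
  have "contact Z h Y a z"
    by (rule contact_limit[OF _ assms(2) LIMSEQ_subseq_LIMSEQ[OF \<open>B \<longlonglongrightarrow> a\<close> s(1)] s(2)])
       (use X assms(1) in \<open>auto simp: compact_imp_closed\<close>)
  then have "z = z0" by (rule assms(3))
  moreover have "r \<le> dist z z0"
    using tendsto_dist[OF s(2) tendsto_const, of z0] X(2)
    by (intro LIMSEQ_le_const) auto
  ultimately show False using \<open>r > 0\<close> by simp
qed

text \<open>Quadratically small increments make the derivative vanish.\<close>

lemma constant_if_quadratic_increments:
  fixes g :: "'a::real_normed_vector \<Rightarrow> real"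
  assumes "\<And>x y. x \<in> ball a r \<Longrightarrow> y \<in> ball a r \<Longrightarrow> \<bar>g y - g x\<bar> \<le> C * (norm (y - x))\<^sup>2"
    and "x \<in> ball a r"
  shows "g x = g a"
proof -
  have r: "a \<in> ball a r" using assms(2) by (simp add: le_less_trans[OF zero_le_dist])
  have "\<exists>c. \<forall>y\<in>ball a r. g y = c"
  proof (rule has_derivative_zero_constant)
    fix y assume y: "y \<in> ball a r"
    show "(g has_derivative (\<lambda>h. 0)) (at y within ball a r)"
      unfolding has_derivative_within
    proof (intro conjI bounded_linear_zero)
      have "((\<lambda>w. \<bar>C\<bar> * norm (w - y)) \<longlongrightarrow> \<bar>C\<bar> * norm (y - y)) (at y within ball a r)"
        by (intro tendsto_intros)
      then have lim: "((\<lambda>w. \<bar>C\<bar> * norm (w - y)) \<longlongrightarrow> 0) (at y within ball a r)" by simp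
      show "((\<lambda>w. (1 / norm (w - y)) *\<^sub>R (g w - (g y + 0))) \<longlongrightarrow> 0) (at y within ball a r)"
      proof (rule Lim_null_comparison[OF _ lim], unfold eventually_at_topological, intro exI conjI ballI impI)
        show "open (UNIV :: 'a set)" "y \<in> UNIV" by auto
        fix w assume w: "w \<noteq> y" "w \<in> ball a r"
        have "\<bar>g w - g y\<bar> \<le> \<bar>C\<bar> * (norm (w - y))\<^sup>2"
          using assms(1)[OF y w(2)] by (smt (verit) mult_right_mono zero_le_power2)
        then show "norm ((1 / norm (w - y)) *\<^sub>R (g w - (g y + 0))) \<le> \<bar>C\<bar> * norm (w - y)"
          using w by (simp add: divide_le_eq power2_eq_square mult_ac)
      qed
    qed
  qed auto
  then show ?thesis using assms(2) r by auto
qed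

lemma countable_union_closed_interior:
  fixes M :: "'b \<Rightarrow> 'a::{real_normed_vector,heine_borel} set"
  assumes "countable I" "\<And>i. i \<in> I \<Longrightarrow> closed (M i)" "ball a r \<subseteq> (\<Union>i\<in>I. M i)" "r > 0"
  shows "\<exists>i\<in>I. interior (M i) \<noteq> {}"
proof (rule ccontr)
  assume "\<not> ?thesis"
  then have "UNIV \<subseteq> closure (\<Inter>((\<lambda>i. - M i) ` I))"
    using assms(1,2) by (intro Baire) (auto simp: closure_complement open_Compl)
  then have "interior (\<Union>i\<in>I. M i) = {}"
    by (auto simp: interior_closure)
  moreover have "a \<in> interior (\<Union>i\<in>I. M i)"
    using assms(3,4) by (auto simp: interior_def)
  ultimately show False by simp
qed

text \<open>The core of the argument. If the contact gradients \<open>Y (x - a)\<close> only take countably many values, one value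
  \<open>c\<close> occurs for a whole ball of translations. There the maximal value is an affine function of the
  translation, so the lower envelope of the touching paraboloids is affine in space with slope \<open>c\<close>. Testing the maximality for two translations against each other also shows that \<open>Y\<close> cannot
  have a negative direction.\<close>

lemma flat_contact:
  fixes Y :: "real^'n^'n"
  assumes "compact Z" "Z \<noteq> {}" "usc_on Z h" "transpose Y = Y" "\<rho> > 0" "countable E"
    and E: "\<And>a z. a \<in> ball a0 \<rho> \<Longrightarrow> contact Z h Y a z \<Longrightarrow> Y *v (fst z - a) \<in> E"
  obtains a z c r where "a \<in> ball a0 \<rho>" "contact Z h Y a z" "Y *v (fst z - a) = c" "r > 0"
    "\<And>w. w \<in> Z \<Longrightarrow> norm (fst w - fst z) < r \<Longrightarrow> h w \<le> h z + c \<bullet> (fst w - fst z)"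
    "\<And>v. 0 \<le> half_form Y v"
proof -
  define M where "M c = {a \<in> cball a0 (\<rho>/2). \<exists>z. contact Z h Y a z \<and> Y *v (fst z - a) = c}" for c
  have "closed (M c)" for c
    unfolding closed_sequential_limits
  proof (intro allI impI, elim conjE)
    fix A a assume AM: "\<forall>n. A n \<in> M c" and A: "A \<longlonglongrightarrow> a"
    then obtain X where X: "\<And>n. contact Z h Y (A n) (X n)" "\<And>n. Y *v (fst (X n) - A n) = c"
    proof -
      have "\<forall>n. \<exists>z. contact Z h Y (A n) z \<and> Y *v (fst z - A n) = c"
        using AM by (simp add: M_def)
      then show thesis using that by metis
    qed
    have "\<And>n. X n \<in> Z" using X by (auto simp: contact_def)
    then obtain z s where s: "strict_mono s" "(X \<circ> s) \<longlonglongrightarrow> z"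
      using \<open>compact Z\<close> unfolding compact_def by meson
    note As = LIMSEQ_subseq_LIMSEQ[OF A s(1)]
    have "contact Z h Y a z"
      by (rule contact_limit[OF _ assms(3) As s(2)])
         (use X assms(1) in \<open>auto simp: compact_imp_closed\<close>)
    moreover have "(\<lambda>n. Y *v (fst ((X \<circ> s) n) - (A \<circ> s) n)) \<longlonglongrightarrow> Y *v (fst z - a)"
      by (intro bounded_linear.tendsto[OF matrix_vector_mul_bounded_linear] tendsto_intros s As)
    then have "Y *v (fst z - a) = c"
      using X(2) by (simp add: LIMSEQ_const_iff)
    moreover have "a \<in> cball a0 (\<rho>/2)"
      by (rule closed_sequentially[OF closed_cball _ A]) (use AM in \<open>simp add: M_def\<close>)
    ultimately show "a \<in> M c" unfolding M_def by blast
  qed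
  moreover have "ball a0 (\<rho>/2) \<subseteq> (\<Union>c\<in>E. M c)"
  proof
    fix a assume a: "a \<in> ball a0 (\<rho>/2)"
    have a': "a \<in> ball a0 \<rho>" "a \<in> cball a0 (\<rho>/2)" using a \<open>\<rho> > 0\<close> by auto
    obtain z where z: "contact Z h Y a z" using contact_exists assms(1-3) by blast
    then have "a \<in> M (Y *v (fst z - a))" using a' unfolding M_def by blast
    then show "a \<in> (\<Union>c\<in>E. M c)" using E[OF a'(1) z] by blast
  qed
  ultimately obtain c where "interior (M c) \<noteq> {}"
    using countable_union_closed_interior[OF \<open>countable E\<close>, of M a0 "\<rho>/2"] \<open>\<rho> > 0\<close> by auto
  then obtain a1 r where r: "r > 0" "ball a1 r \<subseteq> M c"
    by (meson ex_in_conv mem_interior)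
  have "\<forall>a\<in>ball a1 r. \<exists>z. contact Z h Y a z \<and> Y *v (fst z - a) = c"
    using r by (auto simp: M_def)
  then obtain X where X: "\<And>a. a \<in> ball a1 r \<Longrightarrow> contact Z h Y a (X a)"
      and Xc: "\<And>a. a \<in> ball a1 r \<Longrightarrow> Y *v (fst (X a) - a) = c"
    by metis
  define G where "G a = h (X a) - half_form Y (fst (X a) - a)" for a
  \<comment> \<open>the contact point of \<open>a\<close> competes in the maximum defining \<open>G b\<close>\<close>
  have low: "G a + c \<bullet> (b - a) - half_form Y (b - a) \<le> G b" if "a \<in> ball a1 r" "b \<in> ball a1 r" for a b
  proof -
    have "h (X a) - half_form Y (fst (X a) - b) \<le> G b"
      using X[OF that(1)] X[OF that(2)] by (auto simp: contact_def G_def)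
    moreover have "half_form Y (fst (X a) - b) = half_form Y (fst (X a) - a) - c \<bullet> (b - a) + half_form Y (b - a)"
      using half_form_add[OF assms(4), of "fst (X a) - a" "a - b"] Xc[OF that(1)]
        half_form_minus[of Y "b - a"] by (simp add: inner_diff_right)
    ultimately show ?thesis by (simp add: G_def)
  qed
  have nonneg: "0 \<le> half_form Y v" if "v \<in> ball 0 r" for v
  proof -
    have "a1 + v \<in> ball a1 r" "a1 \<in> ball a1 r" using that r by (auto simp: dist_norm)
    from low[OF this] low[OF this(2,1)] show ?thesis
      using half_form_minus[of Y v] by simp
  qed
  have psd: "0 \<le> half_form Y v" for v
  proof (cases "v = 0")
    case False
    have "0 \<le> half_form Y ((r / (2 * norm v)) *\<^sub>R v)"
      using r False by (intro nonneg) simp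
    then have "0 \<le> (r / (2 * norm v))\<^sup>2 * half_form Y v" by (simp add: half_form_scaleR)
    moreover have "(r / (2 * norm v))\<^sup>2 > 0" using r False by simp
    ultimately show ?thesis by (simp add: zero_le_mult_iff)
  qed simp
  have G: "G a = G a1 + c \<bullet> (a - a1)" if "a \<in> ball a1 r" for a
  proof -
    have "G a - c \<bullet> a = G a1 - c \<bullet> a1"
    proof (rule constant_if_quadratic_increments[OF _ that])
      fix x y assume "x \<in> ball a1 r" "y \<in> ball a1 r"
      from low[OF this] low[OF this(2,1)] abs_half_form_le[of Y "y - x"] half_form_minus[of Y "y - x"]
      show "\<bar>(G y - c \<bullet> y) - (G x - c \<bullet> x)\<bar> \<le> onorm ((*v) Y) * (norm (y - x))\<^sup>2"
        by (simp add: inner_diff_right)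
    qed
    then show ?thesis by (simp add: inner_diff_right)
  qed
  define z where "z = X a1"
  have a1: "a1 \<in> ball a1 r" using r by simp
  have "h w \<le> h z + c \<bullet> (fst w - fst z)" if w: "w \<in> Z" "norm (fst w - fst z) < r" for w
  proof -
    \<comment> \<open>translating along with \<open>w\<close> keeps the quadratic term at its value in the contact point\<close>
    define a where "a = a1 + (fst w - fst z)"
    have a: "a \<in> ball a1 r" using w by (simp add: a_def dist_norm norm_minus_commute)
    have "h w - half_form Y (fst w - a) \<le> G a"
      using X[OF a] w by (simp add: contact_def G_def)
    moreover have "fst w - a = fst z - a1" by (simp add: a_def)
    moreover have "G a = h z - half_form Y (fst z - a1) + c \<bullet> (fst w - fst z)"
      using G[OF a] by (simp add: a_def G_def z_def)
    ultimately show ?thesis by simp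
  qed
  moreover have "a1 \<in> M c" using r a1 by auto
  then have "a1 \<in> ball a0 \<rho>" using \<open>\<rho> > 0\<close> by (auto simp: M_def)
  ultimately show ?thesis
    using that[of a1 z c r] X[OF a1] Xc[OF a1] r psd by (simp add: z_def)
qed

lemma countable_int_lattice: "countable (int_lattice :: (real^'n) set)"
proof -
  have "(int_lattice :: (real^'n) set) \<subseteq> range (\<lambda>f :: 'n \<Rightarrow> int. \<chi> i. of_int (f i))"
  proof
    fix k :: "real^'n" assume "k \<in> int_lattice"
    then have "\<forall>i. \<exists>j. k $ i = of_int j" by (auto simp: int_lattice_def elim: Ints_cases)
    then obtain f where "\<And>i. k $ i = of_int (f i)" by metis
    then have "k = (\<chi> i. of_int (f i))" by (simp add: vec_eq_iff)
    then show "k \<in> range (\<lambda>f :: 'n \<Rightarrow> int. \<chi> i. of_int (f i))" by blast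
  qed
  then show ?thesis by (rule countable_subset) simp
qed

text \<open>A line through the origin meets the affine hyperplane through \<open>p\<close> orthogonal to \<open>p\<close> in at most one point, and there are
  only countably many lattice lines.\<close>

lemma countable_orthogonal_rational_shifts:
  fixes p :: "real^'n"
  assumes "p \<noteq> 0"
  shows "countable {v. v \<bullet> p = 0 \<and> p + v \<in> rational_directions}"
proof -
  have "{v. v \<bullet> p = 0 \<and> p + v \<in> rational_directions} \<subseteq>
      (\<lambda>k. ((p \<bullet> p) / (k \<bullet> p)) *\<^sub>R k - p) ` int_lattice"
  proof clarify
    fix v assume v: "v \<bullet> p = 0" "p + v \<in> rational_directions"
    then obtain l k where k: "p + v = l *\<^sub>R k" "k \<in> int_lattice"
      by (auto simp: rational_directions_def)
    have "p \<bullet> p = (p + v) \<bullet> p" using v by (simp add: inner_add_left)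
    then have "p \<bullet> p = l * (k \<bullet> p)" using k by simp
    moreover from this have "k \<bullet> p \<noteq> 0" using assms by auto
    ultimately have "v = ((p \<bullet> p) / (k \<bullet> p)) *\<^sub>R k - p"
      using k(1) by (simp add: algebra_simps)
    then show "v \<in> (\<lambda>k. ((p \<bullet> p) / (k \<bullet> p)) *\<^sub>R k - p) ` int_lattice" using k(2) by blast
  qed
  then show ?thesis
    using countable_image[OF countable_int_lattice] by (rule countable_subset)
qed

section \<open>Polynomial test functions\<close>

lemma real_polynomial_frechet:
  fixes f :: "'a::euclidean_space \<Rightarrow> real"
  assumes "real_polynomial_function f"
  shows "real_polynomial_function (\<lambda>x. frechet_derivative f (at x) v)"
  using assms
proof induction
  case (linear f)
  then have "frechet_derivative f (at x) = f" for x
    by (metis bounded_linear_imp_has_derivative frechet_derivative_at)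
  then show ?case by auto
next
  case (const c)
  show ?case by (simp add: real_polynomial_function.intros(2))
next
  case (add f g)
  then have "(f has_derivative frechet_derivative f (at x)) (at x)"
    "(g has_derivative frechet_derivative g (at x)) (at x)" for x
    by (auto simp: differentiable_at_real_polynomial_function frechet_derivative_works[symmetric])
  from frechet_derivative_at[OF has_derivative_add[OF this], symmetric]
  show ?case using add.IH by auto
next
  case (mult f g)
  then have "(f has_derivative frechet_derivative f (at x)) (at x)"
    "(g has_derivative frechet_derivative g (at x)) (at x)" for x
    by (auto simp: differentiable_at_real_polynomial_function frechet_derivative_works[symmetric])
  from frechet_derivative_at[OF has_derivative_mult[OF this], symmetric]
  show ?case using mult by auto
qed

text \<open>Directional derivatives of polynomials are again polynomials, hence continuous and differentiable.\<close>

lemma smooth_real_polynomial: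
  assumes "real_polynomial_function f"
  shows "smooth_fun_on S f"
  unfolding smooth_fun_on_def
proof
  fix k show "Ck_on k S f"
    using assms
  proof (induction k arbitrary: f)
    case 0
    then show ?case by (simp add: continuous_on_polymonial_function real_polynomial_function_eq)
  next
    case (Suc k)
    then show ?case
      by (simp add: real_polynomial_frechet differentiable_at_real_polynomial_function)
  qed
qed

definition paraboloid ::
  "(real^'n) \<times> real \<Rightarrow> real \<Rightarrow> real^'n \<Rightarrow> real^'n^'n \<Rightarrow> real \<Rightarrow> real \<Rightarrow> (real^'n) \<times> real \<Rightarrow> real" where
  "paraboloid z \<alpha> q M \<beta> D w =
     \<alpha> + q \<bullet> (fst w - fst z) + half_form M (fst w - fst z) + \<beta> * (snd w - snd z) + D * (snd w - snd z)\<^sup>2"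

lemma paraboloid_centre [simp]: "paraboloid z \<alpha> q M \<beta> D z = \<alpha>"
  by (simp add: paraboloid_def)

lemma paraboloid_has_derivative [derivative_intros]:
  assumes "transpose M = M"
  shows "(paraboloid z \<alpha> q M \<beta> D has_derivative
     (\<lambda>v. (q + M *v (fst w - fst z)) \<bullet> fst v + (\<beta> + 2 * D * (snd w - snd z)) * snd v)) (at w)"
proof -
  have *: "((\<lambda>w. M *v (fst w - fst z)) has_derivative (\<lambda>v. M *v fst v)) (at w)"
    by (rule has_derivative_eq_rhs[OF bounded_linear.has_derivative[OF matrix_vector_mul_bounded_linear]])
       (auto intro!: derivative_eq_intros)
  have "((\<lambda>w. half_form M (fst w - fst z)) has_derivative (\<lambda>v. (M *v (fst w - fst z)) \<bullet> fst v)) (at w)"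
    unfolding half_form_def
    by (rule has_derivative_eq_rhs, (rule derivative_eq_intros * refl | simp)+)
       (simp add: fun_eq_iff inner_commute[of "M *v _"] symmetric_form[OF assms, of _ "fst w - fst z"])
  then show ?thesis
    unfolding paraboloid_def [abs_def]
    by (auto intro!: derivative_eq_intros simp: fun_eq_iff inner_add_left algebra_simps power2_eq_square)
qed

lemma real_polynomial_inner:
  fixes f g :: "'a::real_normed_vector \<Rightarrow> 'b::euclidean_space"
  assumes "polynomial_function f" "polynomial_function g"
  shows "real_polynomial_function (\<lambda>x. f x \<bullet> g x)"
proof -
  have "real_polynomial_function (\<lambda>x. f x \<bullet> b)" "real_polynomial_function (\<lambda>x. g x \<bullet> b)" for b
    using assms by (auto simp: real_polynomial_function_eq)
  then have "real_polynomial_function (\<lambda>x. \<Sum>b\<in>Basis. (f x \<bullet> b) * (g x \<bullet> b))"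
    by (intro real_polynomial_function_sum real_polynomial_function.intros(4)) auto
  then show ?thesis
    by (simp add: euclidean_inner[of "f _" "g _"])
qed

lemma real_polynomial_paraboloid:
  fixes z :: "(real^'n) \<times> real"
  shows "real_polynomial_function (paraboloid z \<alpha> q M \<beta> D)"
proof -
  have snd: "real_polynomial_function (\<lambda>w :: (real^'n) \<times> real. snd w)"
    by (intro real_polynomial_function.intros(1) bounded_linear_snd)
  have fst: "polynomial_function (\<lambda>w :: (real^'n) \<times> real. fst w - fst z)"
    by (intro polynomial_function_diff polynomial_function_const
        polynomial_function_bounded_linear[OF bounded_linear_fst])
  have mat: "polynomial_function (\<lambda>w :: (real^'n) \<times> real. M *v (fst w - fst z))"
    using polynomial_function_compose[OF fst polynomial_function_bounded_linear[OF matrix_vector_mul_bounded_linear[of M]]]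
    by (simp add: o_def)
  show ?thesis
    unfolding paraboloid_def [abs_def] half_form_def
    by (intro real_polynomial_function.intros(2-4) real_polynomial_function_divide
        real_polynomial_function_diff real_polynomial_function_power real_polynomial_inner
        polynomial_function_const fst mat snd)
qed

text \<open>The quartic term makes the contact strict and does not affect derivatives of order at most two at \<open>z\<close>.\<close>

definition touching_test ::
  "real \<Rightarrow> real \<Rightarrow> (real^'n) \<times> real \<Rightarrow> real \<Rightarrow> real^'n \<Rightarrow> real^'n^'n \<Rightarrow> real \<Rightarrow> real \<Rightarrow> (real^'n) \<times> real \<Rightarrow> real" where
  "touching_test \<kappa> C z \<alpha> q M \<beta> D w =
     \<kappa> + paraboloid z \<alpha> q M \<beta> D w + C * (paraboloid z \<alpha> q M \<beta> D w)\<^sup>2 + ((w - z) \<bullet> (w - z))\<^sup>2"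

lemma smooth_touching_test:
  fixes z :: "(real^'n) \<times> real"
  shows "smooth_fun_on S (touching_test \<kappa> C z \<alpha> q M \<beta> D)"
proof (rule smooth_real_polynomial)
  have "real_polynomial_function (\<lambda>w :: (real^'n) \<times> real. (w - z) \<bullet> (w - z))"
    by (intro real_polynomial_inner polynomial_function_diff) auto
  then show "real_polynomial_function (touching_test \<kappa> C z \<alpha> q M \<beta> D)"
    unfolding touching_test_def [abs_def]
    by (intro real_polynomial_function.intros(2-4) real_polynomial_function_power
        real_polynomial_paraboloid)
qed

lemma touching_test_has_derivative:
  assumes "transpose M = M"
  shows "(touching_test \<kappa> C z \<alpha> q M \<beta> D has_derivative
     (\<lambda>v. (1 + 2 * C * paraboloid z \<alpha> q M \<beta> D w) *
            ((q + M *v (fst w - fst z)) \<bullet> fst v + (\<beta> + 2 * D * (snd w - snd z)) * snd v) +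
          4 * ((w - z) \<bullet> (w - z)) * ((w - z) \<bullet> v))) (at w)"
  unfolding touching_test_def [abs_def]
  by (auto intro!: derivative_eq_intros assms
      simp: fun_eq_iff algebra_simps power2_eq_square inner_commute)

lemma time_deriv_touching_test:
  assumes "transpose M = M"
  shows "time_deriv (touching_test \<kappa> C z \<alpha> q M \<beta> D) z = (1 + 2 * C * \<alpha>) * \<beta>"
  using frechet_derivative_at[OF touching_test_has_derivative[OF assms], symmetric, of \<kappa> C z \<alpha> q \<beta> D z]
  by (simp add: time_deriv_def)

lemma space_grad_touching_test:
  assumes "transpose M = M"
  shows "space_grad (touching_test \<kappa> C z \<alpha> q M \<beta> D) w =
    (1 + 2 * C * paraboloid z \<alpha> q M \<beta> D w) *\<^sub>R (q + M *v (fst w - fst z)) +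
    (4 * ((w - z) \<bullet> (w - z))) *\<^sub>R (fst w - fst z)"
  using frechet_derivative_at[OF touching_test_has_derivative[OF assms], symmetric, of \<kappa> C z \<alpha> q \<beta> D w]
  by (simp add: space_grad_def vec_eq_iff inner_axis inner_prod_def)

lemma matrix_vector_mult_axis: "(M *v axis j 1) $ i = (M $ i $ j :: real)"
  by (simp add: matrix_vector_mult_basis column_def)

text \<open>The nonlinearity \<open>s + C s\<^sup>2\<close> adds only a multiple of \<open>q \<otimes> q\<close>, which the tangential projection
  orthogonal to \<open>q\<close> annihilates.\<close>

lemma space_hess_touching_test:
  assumes "transpose M = M"
  shows "space_hess (touching_test \<kappa> C z \<alpha> q M \<beta> D) z =
    (1 + 2 * C * \<alpha>) *\<^sub>R M + (2 * C) *\<^sub>R tensor_vec q q"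
proof -
  have "frechet_derivative (\<lambda>w. space_grad (touching_test \<kappa> C z \<alpha> q M \<beta> D) w $ i) (at z) (axis j 1, 0) =
      (1 + 2 * C * \<alpha>) * M $ i $ j + 2 * C * (q $ i * q $ j)" for i j
  proof -
    have M: "((\<lambda>w. (M *v (fst w - fst z)) $ i) has_derivative (\<lambda>v. (M *v fst v) $ i)) (at z)"
      by (rule has_derivative_eq_rhs[OF bounded_linear.has_derivative[OF bounded_linear_compose[OF bounded_linear_vec_nth matrix_vector_mul_bounded_linear, unfolded o_def]]])
         (auto intro!: derivative_eq_intros)
    have F: "((\<lambda>w. (fst w - fst z) $ i) has_derivative (\<lambda>v. fst v $ i)) (at z)"
      by (rule has_derivative_eq_rhs[OF bounded_linear.has_derivative[OF bounded_linear_vec_nth]])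
         (auto intro!: derivative_eq_intros)
    have "((\<lambda>w. (1 + 2 * C * paraboloid z \<alpha> q M \<beta> D w) * (q $ i + (M *v (fst w - fst z)) $ i) +
        (4 * ((w - z) \<bullet> (w - z))) * (fst w - fst z) $ i) has_derivative
        (\<lambda>v. (1 + 2 * C * \<alpha>) * (M *v fst v) $ i + 2 * C * (q \<bullet> fst v + \<beta> * snd v) * q $ i)) (at z)"
      by (rule has_derivative_eq_rhs, (rule derivative_eq_intros paraboloid_has_derivative[OF assms] M F refl)+)
         (simp add: fun_eq_iff)
    from frechet_derivative_at[OF this, symmetric] show ?thesis
      unfolding space_grad_touching_test[OF assms]
      by (simp add: matrix_vector_mult_axis inner_axis)
  qed
  then show ?thesis
    by (simp add: space_hess_def tensor_vec_def vec_eq_iff)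
qed

lemma tensor_vec_mult: "tensor_vec v w *v x = (w \<bullet> x) *\<^sub>R v"
  by (simp add: vec_eq_iff tensor_vec_def matrix_vector_mult_def inner_vec_def sum_distrib_right
      sum_distrib_left mult_ac)

lemma sgn_inner_self: "(sgn q \<bullet> q) *\<^sub>R sgn q = (q :: 'a::real_inner)"
  by (cases "q = 0") (simp_all add: sgn_div_norm field_simps flip: power2_norm_eq_inner power2_eq_square)

lemma tangential_part_tensor: "tangential_part q (tensor_vec q q) = 0"
proof (rule matrix_eq[THEN iffD2], rule allI)
  fix x
  have "tangential_part q (tensor_vec q q) *v x =
      (q \<bullet> x) *\<^sub>R q - (sgn q \<bullet> ((q \<bullet> x) *\<^sub>R q)) *\<^sub>R sgn q"
    by (simp add: tangential_part_def matrix_vector_mul_assoc[symmetric]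
        matrix_vector_mult_diff_rdistrib tensor_vec_mult)
  also have "\<dots> = (q \<bullet> x) *\<^sub>R (q - (sgn q \<bullet> q) *\<^sub>R sgn q)"
    by (simp add: scaleR_diff_right)
  finally show "tangential_part q (tensor_vec q q) *v x = 0 *v x"
    by (simp add: sgn_inner_self)
qed

lemma matrix_scaleR_right: "A ** (c *\<^sub>R B) = c *\<^sub>R (A ** B :: real^'n^'m)"
  by (simp add: vec_eq_iff matrix_matrix_mult_def sum_distrib_left mult_ac)

lemma tangential_part_touching:
  fixes q :: "real^'n"
  assumes "0 < l"
  shows "tangential_part (l *\<^sub>R q) (l *\<^sub>R M + c *\<^sub>R tensor_vec q q) = l *\<^sub>R tangential_part q M"
proof -
  have *: "tangential_part q (l *\<^sub>R M + c *\<^sub>R N) =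
      l *\<^sub>R tangential_part q M + c *\<^sub>R tangential_part q N" for N
    by (simp add: tangential_part_def matrix_add_ldistrib matrix_scaleR_right)
  have "tangential_part (l *\<^sub>R q) = (tangential_part q :: real^'n^'n \<Rightarrow> _)"
    using assms by (simp add: tangential_part_def [abs_def] sgn_scaleR)
  then show ?thesis by (simp add: * tangential_part_tensor)
qed

section \<open>Touching by paraboloids\<close>

lemma scaleR_rational_directions_iff:
  assumes "l \<noteq> 0"
  shows "l *\<^sub>R q \<in> rational_directions \<longleftrightarrow> q \<in> rational_directions"
proof -
  have *: "c *\<^sub>R x \<in> rational_directions" if "x \<in> rational_directions" for c and x :: "real^'n"
    using that by (auto simp: rational_directions_def) (metis scaleR_scaleR)
  show ?thesis
    using *[of q l] *[of "l *\<^sub>R q" "inverse l"] assms by auto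
qed

lemma mat_norm_0 [simp]: "mat_norm (0 :: real^'n^'n) = 0"
proof -
  have "((*v) 0 :: real^'n \<Rightarrow> real^'n) = (\<lambda>x. 0)" by (simp add: fun_eq_iff)
  then show ?thesis by (simp add: mat_norm_def onorm_zero)
qed

text \<open>What the two nontrivial conditions of an irrational subsolution say about a function touched from above
  by \<open>\<kappa> + P + C P\<^sup>2\<close> for a paraboloid \<open>P\<close>. The gradient, the time derivative and the tangential Hessian of the
  test function all carry the factor \<open>1 + 2 C \<alpha> > 0\<close>, which cancels. For rational \<open>q\<close> and \<open>M = 0\<close> the tangential Hessian is zero, so every
  \<open>\<delta> > 0\<close> is allowed and the bound \<open>K \<delta>\<close> on the speed can be made arbitrarily small.\<close>

lemma touched_by_paraboloid:
  fixes u :: "(real^'n) \<times> real \<Rightarrow> real"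
  assumes sub: "irrational_subsolution \<mu> U u"
    and "z \<in> U" "transpose M = M" "q \<noteq> 0" "r > 0" and pos: "0 < 1 + 2 * C * \<alpha>"
    and below: "\<And>w. w \<in> ball z r \<Longrightarrow>
      u w \<le> \<kappa> + paraboloid z \<alpha> q M \<beta> D w + C * (paraboloid z \<alpha> q M \<beta> D w)\<^sup>2"
    and touch: "u z = \<kappa> + \<alpha> + C * \<alpha>\<^sup>2"
  shows "q \<notin> rational_directions \<Longrightarrow> \<mu> (sgn q) * \<beta> \<le> trace (tangential_part q M)"
    and "q \<in> rational_directions \<Longrightarrow> M = 0 \<Longrightarrow> \<beta> \<le> 0"
proof -
  define \<phi> where "\<phi> = touching_test \<kappa> C z \<alpha> q M \<beta> D"
  define l where "l = 1 + 2 * C * \<alpha>"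
  have l: "l > 0" using pos by (simp add: l_def)
  have smooth: "smooth_fun_on spacetime \<phi>"
    by (simp add: \<phi>_def smooth_touching_test)
  have strict: "strict_local_max_on spacetime (\<lambda>w. u w - \<phi> w) z"
    unfolding strict_local_max_on_def
  proof (intro exI[of _ r] conjI ballI impI)
    fix y assume y: "y \<in> ball z r \<inter> spacetime" "y \<noteq> z"
    have "u y - \<phi> y \<le> - ((y - z) \<bullet> (y - z))\<^sup>2"
      using below[of y] y by (simp add: \<phi>_def touching_test_def)
    also have "\<dots> < 0" using y(2) by simp
    also have "0 = u z - \<phi> z" using touch by (simp add: \<phi>_def touching_test_def)
    finally show "u y - \<phi> y < u z - \<phi> z" .
  qed (use \<open>r > 0\<close> in auto)
  have time: "time_deriv \<phi> z = l * \<beta>"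
    using assms(3) by (simp add: \<phi>_def l_def time_deriv_touching_test)
  have grad: "space_grad \<phi> z = l *\<^sub>R q"
    using assms(3) by (simp add: \<phi>_def l_def space_grad_touching_test)
  have tang: "tangential_part (space_grad \<phi> z) (space_hess \<phi> z) = l *\<^sub>R tangential_part q M"
    using l assms(3)
    by (simp add: grad) (simp add: \<phi>_def l_def space_hess_touching_test tangential_part_touching)
  obtain K where K: "K > 0" and
     a: "space_grad \<phi> z \<notin> rational_directions \<Longrightarrow> mcf_operator \<mu> \<phi> z \<le> 0" and
     b: "\<And>\<delta>. \<delta> > 0 \<Longrightarrow> space_grad \<phi> z \<in> rational_directions - {0} \<Longrightarrow>
            mat_norm (tangential_part (space_grad \<phi> z) (space_hess \<phi> z))
              \<le> \<delta> * norm (space_grad \<phi> z) \<Longrightarrow>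
            time_deriv \<phi> z \<le> K * \<delta> * norm (space_grad \<phi> z)"
    using sub smooth strict \<open>z \<in> U\<close> unfolding irrational_subsolution_def by blast
  show "\<mu> (sgn q) * \<beta> \<le> trace (tangential_part q M)" if "q \<notin> rational_directions"
  proof -
    have "mcf_operator \<mu> \<phi> z = l * (\<mu> (sgn q) * \<beta> - trace (tangential_part q M))"
      unfolding mcf_operator_def tang unfolding grad time
      using l by (simp add: sgn_scaleR trace_def sum_distrib_left right_diff_distrib)
    moreover have "mcf_operator \<mu> \<phi> z \<le> 0"
      using that l by (intro a) (simp add: grad scaleR_rational_directions_iff)
    ultimately show ?thesis
      using l by (simp add: mult_le_0_iff)
  qed
  show "\<beta> \<le> 0" if "q \<in> rational_directions" "M = 0"
  proof (rule ccontr)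
    assume "\<not> \<beta> \<le> 0"
    define \<delta> where "\<delta> = \<beta> / (2 * K * norm q)"
    have \<delta>: "\<delta> > 0" using \<open>\<not> \<beta> \<le> 0\<close> K \<open>q \<noteq> 0\<close> by (simp add: \<delta>_def)
    have "time_deriv \<phi> z \<le> K * \<delta> * norm (space_grad \<phi> z)"
      using that l \<delta> \<open>q \<noteq> 0\<close>
      by (intro b) (auto simp: tang, auto simp: grad scaleR_rational_directions_iff tangential_part_def)
    also have "\<dots> = l * (\<beta> / 2)" using l K \<open>q \<noteq> 0\<close> by (simp add: grad \<delta>_def)
    finally show False using l \<open>\<not> \<beta> \<le> 0\<close> by (simp add: time)
  qed
qed

text \<open>The inverse of the increasing branch of \<open>s + C s\<^sup>2\<close>. As \<open>sqrt\<close> is extended to an odd function, this is, for \<open>C > 0\<close>, strictly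
  increasing and continuous on all of \<open>\<real>\<close>, so that it can be composed with \<open>u\<close> without any restriction on the
  values of \<open>u\<close>.\<close>

definition parabola_inverse :: "real \<Rightarrow> real \<Rightarrow> real" where
  "parabola_inverse C v = (sqrt (1 + 4 * C * v) - 1) / (2 * C)"

lemma parabola_inverse_0 [simp]: "parabola_inverse C 0 = 0"
  by (simp add: parabola_inverse_def)

lemma parabola_square: "(1 + 2 * C * r)\<^sup>2 = 1 + 4 * C * (r + C * r\<^sup>2)" for C r :: real
  by (simp add: power2_eq_square algebra_simps)

lemma parabola_inverse_less_iff:
  assumes "C > 0" "0 \<le> 1 + 2 * C * r"
  shows "parabola_inverse C v < r \<longleftrightarrow> v < r + C * r\<^sup>2"
proof -
  have "parabola_inverse C v < r \<longleftrightarrow> sqrt (1 + 4 * C * v) < 1 + 2 * C * r"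
    using assms(1) by (simp add: parabola_inverse_def pos_divide_less_eq algebra_simps)
  also have "\<dots> \<longleftrightarrow> sqrt (1 + 4 * C * v) < sqrt ((1 + 2 * C * r)\<^sup>2)"
    using assms(2) by simp
  also have "\<dots> \<longleftrightarrow> v < r + C * r\<^sup>2"
    using assms(1) by (simp add: parabola_square del: real_sqrt_abs)
  finally show ?thesis .
qed

lemma parabola_inverse_eq_iff:
  assumes "C > 0" "0 \<le> 1 + 2 * C * r"
  shows "parabola_inverse C v = r \<longleftrightarrow> v = r + C * r\<^sup>2"
proof -
  have "parabola_inverse C v = r \<longleftrightarrow> sqrt (1 + 4 * C * v) = 1 + 2 * C * r"
    using assms(1) by (auto simp: parabola_inverse_def field_simps)
  also have "\<dots> \<longleftrightarrow> sqrt (1 + 4 * C * v) = sqrt ((1 + 2 * C * r)\<^sup>2)"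
    using assms(2) by simp
  also have "\<dots> \<longleftrightarrow> v = r + C * r\<^sup>2"
    using assms(1) by (simp add: parabola_square del: real_sqrt_abs)
  finally show ?thesis .
qed

lemma usc_on_parabola_inverse:
  assumes "C > 0" "usc_on S u"
  shows "usc_on S (\<lambda>z. parabola_inverse C (u z - k))"
  unfolding usc_on_def
proof (intro ballI allI impI)
  fix x c assume x: "x \<in> S" "parabola_inverse C (u x - k) < c"
  have mono: "parabola_inverse C a < parabola_inverse C b" if "a < b" for a b
    using that assms(1) by (simp add: parabola_inverse_def divide_strict_right_mono)
  have "((\<lambda>v. parabola_inverse C (v - k)) \<longlongrightarrow> parabola_inverse C (u x - k)) (at_right (u x))"
    unfolding parabola_inverse_def using assms(1) by (intro tendsto_intros) auto
  then have "\<forall>\<^sub>F v in at_right (u x). parabola_inverse C (v - k) < c"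
    using x(2) by (intro order_tendstoD)
  then obtain v where v: "u x < v" "parabola_inverse C (v - k) < c"
    using eventually_happens'[of "at_right (u x)"] eventually_at_right_less[of "u x"]
    by (metis (mono_tags, lifting) eventually_conj trivial_limit_at_right_real)
  have "\<forall>\<^sub>F y in at x within S. u y < v"
    using assms(2) x(1) v(1) by (auto simp: usc_on_def)
  then show "\<forall>\<^sub>F y in at x within S. parabola_inverse C (u y - k) < c"
    by (rule eventually_mono) (use mono v(2) in \<open>smt (verit)\<close>)
qed

lemma matrix_diff_rdistrib: "(A - B) ** M = A ** M - B ** (M :: real^'n^'m)"
  by (simp add: vec_eq_iff matrix_matrix_mult_def sum_subtractf left_diff_distrib)

text \<open>The trace is \<open>tr M - q' \<bullet> M q'\<close> with \<open>q'\<close> the normalised \<open>q\<close>, which is continuous away from \<open>q = 0\<close>.\<close>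

lemma tendsto_tangential_trace:
  assumes "(q \<longlongrightarrow> p) F" "p \<noteq> (0 :: real^'n)"
  shows "((\<lambda>x. trace (tangential_part (q x) M)) \<longlongrightarrow> trace (tangential_part p M)) F"
proof -
  have "trace (tangential_part v M) = trace M - sgn v \<bullet> (M *v sgn v)" for v :: "real^'n"
  proof -
    have "trace (tensor_vec (sgn v) (sgn v) ** M) = sgn v \<bullet> (M *v sgn v)"
      by (subst trace_mul_sym)
        (simp add: trace_def matrix_matrix_mult_def tensor_vec_def inner_vec_def matrix_vector_mult_def
          sum_distrib_left mult_ac)
    moreover have "tangential_part v M = M - tensor_vec (sgn v) (sgn v) ** M"
      by (simp add: tangential_part_def matrix_diff_rdistrib)
    ultimately show ?thesis by (simp add: trace_sub)
  qed
  then show ?thesis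
    by (simp, intro tendsto_intros assms bounded_linear.tendsto[OF matrix_vector_mul_bounded_linear])
qed

lemma trace_nonneg_of_half_form:
  assumes "\<And>v. 0 \<le> half_form Y v"
  shows "0 \<le> trace Y"
  unfolding trace_def
proof (rule sum_nonneg)
  fix i
  show "0 \<le> Y $ i $ i"
    using assms[of "axis i 1"] by (simp add: half_form_def inner_axis' matrix_vector_mult_axis)
qed

lemma orthogonal_range_trace:
  assumes "transpose Y = Y" "\<And>x. (Y *v x) \<bullet> p = 0"
  shows "trace (tangential_part p Y) = trace Y"
proof -
  have "tensor_vec (sgn p) (sgn p) ** Y = 0"
  proof (rule matrix_eq[THEN iffD2], rule allI)
    fix x show "(tensor_vec (sgn p) (sgn p) ** Y) *v x = 0 *v x"
      using assms(2)[of x] by (simp add: matrix_vector_mul_assoc[symmetric] tensor_vec_mult sgn_div_norm inner_commute)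
  qed
  then show ?thesis by (simp add: tangential_part_def matrix_diff_rdistrib)
qed

text \<open>The equation at a point where \<open>u\<close> is touched by \<open>P + C P\<^sup>2\<close>, with a paraboloid \<open>P\<close> whose quadratic part
  is purely tangential. The proof is by contradiction: if the inequality fails, translated paraboloids cannot
  touch with an irrational gradient, and then \<open>flat_contact\<close> produces a touching function that
  is affine in space with rational gradient.\<close>

lemma touching_bound:
  fixes u :: "(real^'n) \<times> real \<Rightarrow> real"
  assumes sub: "irrational_subsolution \<mu> U u" and "open U" "U \<subseteq> spacetime" "z0 \<in> U"
    and \<mu>: "continuous_on (sphere 0 1) \<mu>" "\<And>e. 0 \<le> \<mu> e"
    and Y: "transpose Y = Y" "\<And>x. (Y *v x) \<bullet> p = 0" and p: "p \<noteq> 0" and C: "C > 0" and "R > 0"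
    and below: "\<And>w. w \<in> ball z0 R \<Longrightarrow> w \<noteq> z0 \<Longrightarrow>
      u w - u z0 < paraboloid z0 0 p Y b D w + C * (paraboloid z0 0 p Y b D w)\<^sup>2"
  shows "\<mu> (sgn p) * b \<le> trace Y"
proof (rule ccontr)
  assume contra: "\<not> ?thesis"
  define x0 where "x0 = fst z0"
  define t0 where "t0 = snd z0"
  define P where "P = paraboloid z0 0 p Y b D"
  define f where "f = parabola_inverse C"
  define lin where "lin w = p \<bullet> (fst w - x0) + b * (snd w - t0) + D * (snd w - t0)\<^sup>2" for w :: "(real^'n) \<times> real"
  define h where "h w = f (u w - u z0) - lin w" for w
  have P_eq: "P w = lin w + half_form Y (fst w - x0)" for w
    by (simp add: P_def paraboloid_def lin_def x0_def t0_def)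
  \<comment> \<open>on a small compact ball \<open>s + C s\<^sup>2\<close> is increasing at the values of \<open>P\<close>\<close>
  have "\<forall>\<^sub>F w in nhds z0. 0 < 1 + 2 * C * P w"
  proof -
    have "isCont P z0" unfolding P_def by (rule has_derivative_continuous[OF paraboloid_has_derivative[OF Y(1)]])
    then have "((\<lambda>w. 1 + 2 * C * P w) \<longlongrightarrow> 1 + 2 * C * P z0) (nhds z0)"
      by (intro tendsto_intros) (simp add: isCont_def tendsto_at_iff_tendsto_nhds)
    then show ?thesis by (rule order_tendstoD) (simp add: P_def)
  qed
  moreover have "\<forall>\<^sub>F w in nhds z0. w \<in> U"
    using \<open>open U\<close> \<open>z0 \<in> U\<close> by (simp add: eventually_nhds_in_open)
  moreover have "\<forall>\<^sub>F w in nhds z0. w \<in> ball z0 R"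
    using \<open>R > 0\<close> by (intro eventually_nhds_in_open) auto
  ultimately have "\<forall>\<^sub>F w in nhds z0. 0 < 1 + 2 * C * P w \<and> w \<in> U \<and> w \<in> ball z0 R"
    by eventually_elim auto
  then obtain d where d: "d > 0" "\<And>w. dist w z0 < d \<Longrightarrow> 0 < 1 + 2 * C * P w \<and> w \<in> U \<and> w \<in> ball z0 R"
    unfolding eventually_nhds_metric by blast
  define Z where "Z = cball z0 (d/2)"
  have Z: "compact Z" "Z \<noteq> {}" "z0 \<in> Z"
    using d by (auto simp: Z_def)
  have inZ: "0 < 1 + 2 * C * P w \<and> w \<in> U \<and> w \<in> ball z0 R" if "w \<in> Z" for w
    using that d by (intro d) (auto simp: Z_def dist_commute)
  have usc: "usc_on Z h"
  proof -
    have "usc_on spacetime u" using sub by (simp add: irrational_subsolution_def)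
    then have "usc_on Z u"
      using inZ \<open>U \<subseteq> spacetime\<close> unfolding usc_on_def
      by (meson at_le filter_leD subset_iff)
    then have "usc_on Z (\<lambda>w. f (u w - u z0))"
      unfolding f_def by (rule usc_on_parabola_inverse[OF C])
    then have "usc_on Z (\<lambda>w. f (u w - u z0) + - lin w)"
      unfolding lin_def by (rule usc_on_add_continuous) (intro continuous_intros)
    then show ?thesis by (simp add: h_def [abs_def])
  qed
  have h0: "h z0 = 0" by (simp add: h_def f_def lin_def x0_def t0_def)
  \<comment> \<open>strictness of the touching is uniqueness of the contact for the untranslated paraboloid\<close>
  have unique: "z = z0" if "contact Z h Y x0 z" for z
  proof (rule ccontr)
    assume "z \<noteq> z0"
    have z: "z \<in> Z" "h z0 - half_form Y (fst z0 - x0) \<le> h z - half_form Y (fst z - x0)"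
      using that Z by (auto simp: contact_def)
    have "u z - u z0 < P z + C * (P z)\<^sup>2"
      unfolding P_def using inZ[OF z(1)] \<open>z \<noteq> z0\<close> by (intro below) auto
    then have "f (u z - u z0) < P z"
      unfolding f_def using inZ[OF z(1)] C by (simp add: parabola_inverse_less_iff)
    with z(2) h0 show False by (simp add: h_def P_eq x0_def)
  qed
  \<comment> \<open>spatial gradient, time derivative and a lower bound for \<open>f (u - u z0)\<close> at a contact point;
      the strict inequalities at \<open>z0\<close> persist for nearby contact points\<close>
  define q where "q a z = p + Y *v (fst z - a)" for a and z :: "(real^'n) \<times> real"
  define \<beta> where "\<beta> z = b + 2 * D * (snd z - t0)" for z :: "(real^'n) \<times> real"
  define low where "low a z = half_form Y (fst z - a) - half_form Y (x0 - a) + lin z" for a z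
  have "\<exists>e>0. \<forall>a z. dist a x0 < e \<longrightarrow> dist z z0 < e \<longrightarrow>
     trace (tangential_part (q a z) Y) < \<mu> (sgn (q a z)) * \<beta> z \<and> 0 < 1 + 2 * C * low a z \<and>
     (0 < b \<longrightarrow> 0 < \<beta> z)"
  proof -
    have F: "((\<lambda>y. fst y) \<longlongrightarrow> x0) (nhds (x0, z0))" "((\<lambda>y. fst (snd y)) \<longlongrightarrow> x0) (nhds (x0, z0))"
      "((\<lambda>y. snd (snd y)) \<longlongrightarrow> t0) (nhds (x0, z0))"
      unfolding x0_def t0_def
      by (rule tendsto_eq_intros tendsto_ident_at filterlim_ident | simp)+
    have q: "((\<lambda>y. q (fst y) (snd y)) \<longlongrightarrow> p + Y *v (x0 - x0)) (nhds (x0, z0))"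
      unfolding q_def
      by (intro tendsto_intros F bounded_linear.tendsto[OF matrix_vector_mul_bounded_linear])
    then have q: "((\<lambda>y. q (fst y) (snd y)) \<longlongrightarrow> p) (nhds (x0, z0))" by simp
    have \<beta>: "((\<lambda>y. \<beta> (snd y)) \<longlongrightarrow> b + 2 * D * (t0 - t0)) (nhds (x0, z0))"
      unfolding \<beta>_def by (intro tendsto_intros F)
    have low: "((\<lambda>y. low (fst y) (snd y)) \<longlongrightarrow> half_form Y (x0 - x0) - half_form Y (x0 - x0) +
        (p \<bullet> (x0 - x0) + b * (t0 - t0) + D * (t0 - t0)\<^sup>2)) (nhds (x0, z0))"
      unfolding low_def lin_def by (intro tendsto_intros F)
    have ne: "\<forall>\<^sub>F y in nhds (x0, z0). q (fst y) (snd y) \<noteq> 0"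
      using q p by (rule tendsto_imp_eventually_ne)
    have mu: "((\<lambda>y. \<mu> (sgn (q (fst y) (snd y)))) \<longlongrightarrow> \<mu> (sgn p)) (nhds (x0, z0))"
    proof (rule continuous_on_tendsto_compose[OF \<mu>(1) tendsto_sgn[OF q p]])
      show "sgn p \<in> sphere 0 1" using p by (simp add: norm_sgn)
      show "\<forall>\<^sub>F y in nhds (x0, z0). sgn (q (fst y) (snd y)) \<in> sphere 0 1"
        using ne by eventually_elim (simp add: norm_sgn)
    qed
    have "((\<lambda>y. \<mu> (sgn (q (fst y) (snd y))) * \<beta> (snd y) - trace (tangential_part (q (fst y) (snd y)) Y))
        \<longlongrightarrow> \<mu> (sgn p) * (b + 2 * D * (t0 - t0)) - trace (tangential_part p Y)) (nhds (x0, z0))"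
      by (intro tendsto_diff tendsto_mult mu \<beta> tendsto_tangential_trace q p)
    then have "\<forall>\<^sub>F y in nhds (x0, z0). 0 < \<mu> (sgn (q (fst y) (snd y))) * \<beta> (snd y) - trace (tangential_part (q (fst y) (snd y)) Y)"
      by (rule order_tendstoD) (use contra orthogonal_range_trace[OF Y] in simp)
    moreover have "((\<lambda>y. 1 + 2 * C * low (fst y) (snd y)) \<longlongrightarrow> 1 + 2 * C * 0) (nhds (x0, z0))"
      using low by (intro tendsto_intros) simp
    then have "\<forall>\<^sub>F y in nhds (x0, z0). 0 < 1 + 2 * C * low (fst y) (snd y)"
      by (rule order_tendstoD) simp
    moreover have "\<forall>\<^sub>F y in nhds (x0, z0). 0 < b \<longrightarrow> 0 < \<beta> (snd y)"
    proof (cases "0 < b")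
      case True
      then have "\<forall>\<^sub>F y in nhds (x0, z0). 0 < \<beta> (snd y)"
        by (intro order_tendstoD(1)[OF \<beta>]) simp
      then show ?thesis by eventually_elim simp
    qed simp
    ultimately have "\<forall>\<^sub>F y in nhds (x0, z0). trace (tangential_part (q (fst y) (snd y)) Y) < \<mu> (sgn (q (fst y) (snd y))) * \<beta> (snd y)
       \<and> 0 < 1 + 2 * C * low (fst y) (snd y) \<and> (0 < b \<longrightarrow> 0 < \<beta> (snd y))"
      by eventually_elim auto
    then obtain e where e: "e > 0" "\<And>y. dist y (x0, z0) < e \<Longrightarrow>
       trace (tangential_part (q (fst y) (snd y)) Y) < \<mu> (sgn (q (fst y) (snd y))) * \<beta> (snd y)
       \<and> 0 < 1 + 2 * C * low (fst y) (snd y) \<and> (0 < b \<longrightarrow> 0 < \<beta> (snd y))"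
      unfolding eventually_nhds_metric by blast
    show ?thesis
    proof (intro exI[of _ "e/2"] conjI allI impI)
      fix a z assume "dist a x0 < e/2" "dist z z0 < e/2"
      then have "dist (a, z) (x0, z0) < e"
        unfolding dist_Pair_Pair by (intro le_less_trans[OF sqrt_sum_squares_le_sum]) auto
      from e(2)[OF this]
      show "trace (tangential_part (q a z) Y) < \<mu> (sgn (q a z)) * \<beta> z"
         "0 < 1 + 2 * C * low a z" "0 < b \<Longrightarrow> 0 < \<beta> z" by auto
    qed (use e in auto)
  qed
  then obtain e where e: "e > 0" and near: "\<And>a z. dist a x0 < e \<Longrightarrow> dist z z0 < e \<Longrightarrow>
     trace (tangential_part (q a z) Y) < \<mu> (sgn (q a z)) * \<beta> z \<and> 0 < 1 + 2 * C * low a z \<and>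
     (0 < b \<longrightarrow> 0 < \<beta> z)" by blast
  have "min e (d/2) > 0" using e d by simp
  from contact_near[OF Z(1) usc unique this] obtain \<rho>' where \<rho>': "\<rho>' > 0"
    "\<And>a z. dist a x0 < \<rho>' \<Longrightarrow> contact Z h Y a z \<Longrightarrow> dist z z0 < min e (d/2)" by blast
  define \<rho> where "\<rho> = min \<rho>' e"
  have \<rho>: "\<rho> > 0" using \<rho>' e by (simp add: \<rho>_def)
  have at_contact: "trace (tangential_part (q a z) Y) < \<mu> (sgn (q a z)) * \<beta> z"
      "0 < 1 + 2 * C * f (u z - u z0)" "0 < b \<longrightarrow> 0 < \<beta> z" "z \<in> U" "ball z (d/2 - dist z z0) \<subseteq> Z"
      "0 < d/2 - dist z z0" "q a z \<noteq> 0"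
    if "a \<in> ball x0 \<rho>" "contact Z h Y a z" for a z
  proof -
    have a: "dist a x0 < e" "dist a x0 < \<rho>'" using that(1) by (auto simp: \<rho>_def dist_commute)
    then have z: "dist z z0 < e" "dist z z0 < d/2" using \<rho>'(2)[of a z] that(2) by auto
    show "trace (tangential_part (q a z) Y) < \<mu> (sgn (q a z)) * \<beta> z" "0 < b \<longrightarrow> 0 < \<beta> z"
      using near[OF a(1) z(1)] by auto
    have "h z0 - half_form Y (fst z0 - a) \<le> h z - half_form Y (fst z - a)"
      using that(2) Z(3) by (auto simp: contact_def)
    then have "low a z \<le> f (u z - u z0)"
      using h0 by (simp add: h_def low_def x0_def)
    then have "C * low a z \<le> C * f (u z - u z0)" using C by simp
    then show "0 < 1 + 2 * C * f (u z - u z0)"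
      using near[OF a(1) z(1)] by linarith
    show "z \<in> U" using d(2)[of z] z d(1) by auto
    show "0 < d/2 - dist z z0" using z by simp
    show "ball z (d/2 - dist z z0) \<subseteq> Z"
    proof
      fix w assume "w \<in> ball z (d/2 - dist z z0)"
      then show "w \<in> Z" using dist_triangle[of z0 w z] by (simp add: Z_def dist_commute)
    qed
    \<comment> \<open>the component along \<open>p\<close> never changes\<close>
    have "q a z \<bullet> p = p \<bullet> p" using Y(2) by (simp add: q_def inner_add_left)
    then show "q a z \<noteq> 0" using p by auto
  qed
  \<comment> \<open>a paraboloid touching \<open>f (u - u z0)\<close> from above yields a test function for \<open>u\<close>\<close>
  have transfer: "(v \<notin> rational_directions \<longrightarrow> \<mu> (sgn v) * \<beta> z \<le> trace (tangential_part v M)) \<and>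
      (v \<in> rational_directions \<longrightarrow> M = 0 \<longrightarrow> \<beta> z \<le> 0)"
    if a: "a \<in> ball x0 \<rho>" "contact Z h Y a z" and M: "transpose M = M" and v: "v \<noteq> 0" and r: "r > 0"
      and bound: "\<And>w. w \<in> Z \<Longrightarrow> dist w z < r \<Longrightarrow>
        f (u w - u z0) \<le> paraboloid z (f (u z - u z0)) v M (\<beta> z) D w" for a z v M r
  proof -
    define \<alpha> where "\<alpha> = f (u z - u z0)"
    define A where "A = paraboloid z \<alpha> v M (\<beta> z) D"
    have "isCont A z"
      unfolding A_def by (rule has_derivative_continuous[OF paraboloid_has_derivative[OF M]])
    then have "((\<lambda>w. 1 + 2 * C * A w) \<longlongrightarrow> 1 + 2 * C * A z) (nhds z)"
      by (intro tendsto_intros) (simp add: isCont_def tendsto_at_iff_tendsto_nhds)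
    then have "\<forall>\<^sub>F w in nhds z. 0 < 1 + 2 * C * A w"
      by (rule order_tendstoD) (use at_contact(2)[OF a] in \<open>simp add: A_def \<alpha>_def\<close>)
    then obtain r2 where r2: "r2 > 0" "\<And>w. dist w z < r2 \<Longrightarrow> 0 < 1 + 2 * C * A w"
      unfolding eventually_nhds_metric by blast
    define s where "s = min r (min r2 (d/2 - dist z z0))"
    have s: "s > 0" using r r2 at_contact(6)[OF a] by (simp add: s_def)
    have below': "u w \<le> u z0 + A w + C * (A w)\<^sup>2" if w: "w \<in> ball z s" for w
    proof -
      have "w \<in> Z" using at_contact(5)[OF a] w by (auto simp: s_def)
      then have "f (u w - u z0) \<le> A w"
        using bound[of w] w by (simp add: s_def A_def \<alpha>_def dist_commute)
      moreover have "0 < 1 + 2 * C * A w" using r2(2)[of w] w by (simp add: s_def dist_commute)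
      ultimately have "u w - u z0 \<le> A w + C * (A w)\<^sup>2"
        using parabola_inverse_less_iff[OF C, of "A w" "u w - u z0"]
          parabola_inverse_eq_iff[OF C, of "A w" "u w - u z0"] by (auto simp: f_def le_less)
      then show ?thesis by simp
    qed
    have touch: "u z = u z0 + \<alpha> + C * \<alpha>\<^sup>2"
      using parabola_inverse_eq_iff[OF C, of \<alpha> "u z - u z0"] at_contact(2)[OF a]
      by (simp add: \<alpha>_def f_def)
    have pos: "0 < 1 + 2 * C * \<alpha>" using at_contact(2)[OF a] by (simp add: \<alpha>_def)
    show ?thesis
      using touched_by_paraboloid[OF sub at_contact(4)[OF a] M v s pos below'[unfolded A_def] touch]
      by blast
  qed
  \<comment> \<open>an irrational contact gradient would contradict the strict inequality in \<open>at_contact\<close>\<close>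
  have rational: "q a z \<in> rational_directions" if a: "a \<in> ball x0 \<rho>" "contact Z h Y a z" for a z
  proof (rule ccontr)
    assume irr: "q a z \<notin> rational_directions"
    have "f (u w - u z0) \<le> paraboloid z (f (u z - u z0)) (q a z) Y (\<beta> z) D w" if "w \<in> Z" for w
    proof -
      have "h w - half_form Y (fst w - a) \<le> h z - half_form Y (fst z - a)"
        using a(2) that by (auto simp: contact_def)
      moreover have "half_form Y (fst w - a) = half_form Y (fst z - a) + (Y *v (fst z - a)) \<bullet> (fst w - fst z)
          + half_form Y (fst w - fst z)"
        using half_form_add[OF Y(1), of "fst z - a" "fst w - fst z"] by simp
      ultimately show ?thesis
        by (simp add: paraboloid_def h_def lin_def q_def \<beta>_def inner_add_left inner_diff_right
            algebra_simps power2_eq_square)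
    qed
    then have "\<mu> (sgn (q a z)) * \<beta> z \<le> trace (tangential_part (q a z) Y)"
      using transfer[OF a Y(1) at_contact(7)[OF a] zero_less_one] irr by blast
    with at_contact(1)[OF a] show False by simp
  qed
  have "Y *v (fst z - a) \<in> {v. v \<bullet> p = 0 \<and> p + v \<in> rational_directions}"
    if "a \<in> ball x0 \<rho>" "contact Z h Y a z" for a z
    using rational[OF that] Y(2) by (simp add: q_def)
  from flat_contact[OF Z(1,2) usc Y(1) \<rho> countable_orthogonal_rational_shifts[OF p] this]
  obtain a z c r where a: "a \<in> ball x0 \<rho>" "contact Z h Y a z" and c: "Y *v (fst z - a) = c"
    and r: "r > 0"
    and flat: "\<And>w. w \<in> Z \<Longrightarrow> norm (fst w - fst z) < r \<Longrightarrow> h w \<le> h z + c \<bullet> (fst w - fst z)"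
    and psd: "\<And>v. 0 \<le> half_form Y v"
    by blast
  have qc: "q a z = p + c" using c by (simp add: q_def)
  have "f (u w - u z0) \<le> paraboloid z (f (u z - u z0)) (q a z) 0 (\<beta> z) D w"
    if w: "w \<in> Z" "dist w z < r" for w
  proof -
    have "norm (fst w - fst z) < r"
      using dist_fst_le[of w z] w(2) by (simp add: dist_norm)
    from flat[OF w(1) this] show ?thesis
      by (simp add: paraboloid_def h_def lin_def qc \<beta>_def inner_add_left inner_diff_right
            half_form_def algebra_simps power2_eq_square)
  qed
  then have "\<beta> z \<le> 0"
    using transfer[OF a _ at_contact(7)[OF a] r, of 0] rational[OF a] by (simp add: transpose_def vec_eq_iff)
  moreover have "0 < b"
  proof -
    have "0 < \<mu> (sgn p) * b" using trace_nonneg_of_half_form[OF psd] contra by simp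
    then show ?thesis using \<mu>(2)[of "sgn p"] by (simp add: zero_less_mult_iff)
  qed
  ultimately show False using at_contact(3)[OF a] by simp
qed

section \<open>Majorants of smooth functions\<close>

text \<open>Differentiability of the gradient at the single point \<open>z\<close> suffices: the remainder is differentiated along the
  segment from \<open>z\<close> to \<open>z + v\<close> and estimated by the mean value theorem.\<close>

lemma second_order_expansion:
  fixes \<phi> :: "'a::real_inner \<Rightarrow> real"
  assumes "open S" "z \<in> S"
    and G: "\<And>w. w \<in> S \<Longrightarrow> (\<phi> has_derivative (\<lambda>v. G w \<bullet> v)) (at w)"
    and H: "(G has_derivative H) (at z)" and "\<eta> > 0"
  shows "\<exists>r>0. \<forall>v. norm v < r \<longrightarrow> \<bar>\<phi> (z + v) - \<phi> z - G z \<bullet> v - (v \<bullet> H v) / 2\<bar> \<le> \<eta> * (norm v)\<^sup>2"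
proof -
  obtain d where d: "d > 0" "\<And>w. norm (w - z) < d \<Longrightarrow> norm (G w - G z - H (w - z)) \<le> \<eta> * norm (w - z)"
    using H \<open>\<eta> > 0\<close> unfolding has_derivative_at_alt by blast
  obtain r where r: "r > 0" "ball z r \<subseteq> S"
    using assms(1,2) openE by blast
  have lin: "linear H" using H by (rule has_derivative_linear)
  show ?thesis
  proof (intro exI[of _ "min d r"] conjI allI impI)
    fix v :: 'a assume v: "norm v < min d r"
    define k where "k t = \<phi> (z + t *\<^sub>R v) - t * (G z \<bullet> v) - t\<^sup>2 * ((v \<bullet> H v) / 2)" for t
    define k' where "k' t = (G (z + t *\<^sub>R v) - G z - H (t *\<^sub>R v)) \<bullet> v" for t
    have "(k has_real_derivative k' t) (at t)" if "0 \<le> t" "t \<le> 1" for t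
    proof -
      have tv: "norm (t *\<^sub>R v) \<le> norm v" using that by (simp add: mult_left_le_one_le)
      then have "z + t *\<^sub>R v \<in> S" using r v by (auto simp: dist_norm subset_iff)
      note G[OF this]
      moreover have "((\<lambda>t. z + t *\<^sub>R v) has_derivative (\<lambda>s. s *\<^sub>R v)) (at t)"
        by (auto intro!: derivative_eq_intros)
      ultimately have "((\<lambda>t. \<phi> (z + t *\<^sub>R v)) has_derivative (\<lambda>s. G (z + t *\<^sub>R v) \<bullet> (s *\<^sub>R v))) (at t)"
        by (rule has_derivative_compose[rotated])
      then have "((\<lambda>t. \<phi> (z + t *\<^sub>R v)) has_real_derivative (G (z + t *\<^sub>R v) \<bullet> v)) (at t)"
        by (simp add: has_field_derivative_def mult.commute[of _ "_ \<bullet> _"])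
      then show ?thesis
        unfolding k_def k'_def
        by (auto intro!: derivative_eq_intros simp: linear_scale[OF lin] inner_diff_left inner_commute[of v])
    qed
    from MVT2[of 0 1 k k', OF _ this] obtain t where t: "0 < t" "t < 1" "k 1 - k 0 = k' t"
      by auto
    have "\<bar>k' t\<bar> \<le> norm (G (z + t *\<^sub>R v) - G z - H (t *\<^sub>R v)) * norm v"
      unfolding k'_def by (rule Cauchy_Schwarz_ineq2)
    also have "\<dots> \<le> (\<eta> * norm v) * norm v"
    proof (rule mult_right_mono)
      have tv: "norm (t *\<^sub>R v) \<le> norm v" using t by (simp add: mult_left_le_one_le)
      then have "norm (G (z + t *\<^sub>R v) - G z - H (t *\<^sub>R v)) \<le> \<eta> * norm (t *\<^sub>R v)"
        using d(2)[of "z + t *\<^sub>R v"] v by simp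
      also have "\<dots> \<le> \<eta> * norm v" using tv \<open>\<eta> > 0\<close> by (intro mult_left_mono) auto
      finally show "norm (G (z + t *\<^sub>R v) - G z - H (t *\<^sub>R v)) \<le> \<eta> * norm v" .
    qed simp
    finally show "\<bar>\<phi> (z + v) - \<phi> z - G z \<bullet> v - (v \<bullet> H v) / 2\<bar> \<le> \<eta> * (norm v)\<^sup>2"
      using t(3) by (simp add: k_def power2_eq_square mult_ac)
  qed (use d r in auto)
qed

lemma spacetime_open: "open spacetime"
  by (auto simp: spacetime_def intro: open_Times)

lemma smooth_spacetime_gradient:
  fixes \<phi> :: "(real^'n) \<times> real \<Rightarrow> real"
  assumes "smooth_fun_on spacetime \<phi>" "z \<in> spacetime"
  obtains H where
    "\<And>w. w \<in> spacetime \<Longrightarrow>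
       (\<phi> has_derivative (\<lambda>v. (space_grad \<phi> w, time_deriv \<phi> w) \<bullet> v)) (at w)"
    "((\<lambda>w. (space_grad \<phi> w, time_deriv \<phi> w)) has_derivative H) (at z)"
    "\<And>x y. (x, 0) \<bullet> H (y, 0) = x \<bullet> (space_hess \<phi> z *v y)"
proof -
  have C2: "Ck_on (Suc (Suc 0)) spacetime \<phi>"
    using assms(1) by (simp add: smooth_fun_on_def del: Ck_on.simps)
  have C1: "\<phi> differentiable (at w)" if "w \<in> spacetime" for w
    using C2 that by simp
  have D2: "(\<lambda>x. frechet_derivative \<phi> (at x) v) differentiable (at z)" for v
    using C2 assms(2) by (simp del: split_paired_All)
  have first: "(\<phi> has_derivative (\<lambda>v. (space_grad \<phi> w, time_deriv \<phi> w) \<bullet> v)) (at w)"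
    if "w \<in> spacetime" for w
  proof -
    have D: "(\<phi> has_derivative frechet_derivative \<phi> (at w)) (at w)"
      using C1[OF that] by (simp add: frechet_derivative_works)
    then have lin: "linear (frechet_derivative \<phi> (at w))" by (rule has_derivative_linear)
    have "frechet_derivative \<phi> (at w) (y, s) = (space_grad \<phi> w, time_deriv \<phi> w) \<bullet> (y, s)" for y s
    proof -
      have "(y, s) = (\<Sum>i\<in>UNIV. y $ i *\<^sub>R (axis i 1, 0)) + s *\<^sub>R (0, 1)"
        using basis_expansion[of y]
        by (simp add: prod_eq_iff fst_sum snd_sum scalar_mult_eq_scaleR)
      then have "frechet_derivative \<phi> (at w) (y, s) =
          (\<Sum>i\<in>UNIV. y $ i * frechet_derivative \<phi> (at w) (axis i 1, 0)) + s * frechet_derivative \<phi> (at w) (0, 1)"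
        by (simp only: linear_add[OF lin] linear_sum[OF lin] linear_scale[OF lin] real_scaleR_def)
      then show ?thesis
        by (simp add: space_grad_def time_deriv_def inner_vec_def mult.commute)
    qed
    then have "frechet_derivative \<phi> (at w) = (\<lambda>v. (space_grad \<phi> w, time_deriv \<phi> w) \<bullet> v)"
      by (simp add: fun_eq_iff)
    with D show ?thesis by simp
  qed
  have grad: "((\<lambda>w. space_grad \<phi> w $ i) has_derivative frechet_derivative (\<lambda>w. space_grad \<phi> w $ i) (at z)) (at z)" for i
    using D2[of "(axis i 1, 0)"] by (simp add: frechet_derivative_works[symmetric] space_grad_def)
  have time: "(time_deriv \<phi> has_derivative frechet_derivative (time_deriv \<phi>) (at z)) (at z)"
    using D2[of "(0, 1)"] by (simp add: frechet_derivative_works[symmetric] time_deriv_def [abs_def])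
  define H where "H v = ((\<chi> i. frechet_derivative (\<lambda>w. space_grad \<phi> w $ i) (at z) v) :: real^'n,
      frechet_derivative (time_deriv \<phi>) (at z) v)" for v
  have "((\<lambda>w. (space_grad \<phi> w, time_deriv \<phi> w)) has_derivative H) (at z)"
    unfolding H_def
  proof (intro has_derivative_Pair time)
    show "(space_grad \<phi> has_derivative (\<lambda>v. \<chi> i. frechet_derivative (\<lambda>w. space_grad \<phi> w $ i) (at z) v)) (at z)"
      by (subst has_derivative_componentwise_within) (auto simp: Basis_vec_def inner_axis grad)
  qed
  moreover have "(x, 0) \<bullet> H (y, 0) = x \<bullet> (space_hess \<phi> z *v y)" for x y
  proof -
    have "frechet_derivative (\<lambda>w. space_grad \<phi> w $ i) (at z) (y, 0) =
        (\<Sum>j\<in>UNIV. y $ j * frechet_derivative (\<lambda>w. space_grad \<phi> w $ i) (at z) (axis j 1, 0))" for i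
    proof -
      note lin = has_derivative_linear[OF grad[of i]]
      have "(y, 0 :: real) = (\<Sum>j\<in>UNIV. y $ j *\<^sub>R (axis j 1, 0))"
        using basis_expansion[of y]
        by (simp add: prod_eq_iff fst_sum snd_sum scalar_mult_eq_scaleR)
      then show ?thesis
        by (simp only: linear_sum[OF lin] linear_scale[OF lin] real_scaleR_def)
    qed
    then show ?thesis
      by (simp add: H_def space_hess_def matrix_vector_mult_def inner_vec_def mult.commute)
  qed
  ultimately show thesis using that first by blast
qed

lemma young_product:
  fixes a b h e :: real
  assumes "e > 0"
  shows "h * (a * b) \<le> e * a\<^sup>2 + (h\<^sup>2 / (4 * e)) * b\<^sup>2"
proof -
  have "0 \<le> (2 * e * a - h * b)\<^sup>2 / (4 * e)" using assms by simp
  also have "\<dots> = e * a\<^sup>2 + (h\<^sup>2 / (4 * e)) * b\<^sup>2 - h * (a * b)"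
    using assms by (simp add: power2_eq_square field_simps)
  finally show ?thesis by simp
qed

text \<open>Splitting the displacement into its part orthogonal to \<open>e\<close> and the rest, Young's inequality moves the mixed
  second derivatives into the large constant \<open>C\<close> in front of the squares of the normal and time components, at the
  price of a small \<open>\<epsilon>\<close> in the tangential directions.\<close>

lemma tangential_expansion:
  fixes \<phi> :: "(real^'n) \<times> real \<Rightarrow> real"
  assumes "smooth_fun_on spacetime \<phi>" "z \<in> spacetime" "\<epsilon> > 0" "norm e = 1"
  obtains C r where "C > 0" "r > 0"
    "\<And>y s. norm (y, s) < r \<Longrightarrow> \<phi> (z + (y, s)) \<le> \<phi> z + space_grad \<phi> z \<bullet> y + time_deriv \<phi> z * s +
       half_form (space_hess \<phi> z) (y - (e \<bullet> y) *\<^sub>R e) + \<epsilon> * (norm (y - (e \<bullet> y) *\<^sub>R e))\<^sup>2 +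
       C * ((e \<bullet> y)\<^sup>2 + s\<^sup>2)"
proof -
  obtain H where G: "\<And>w. w \<in> spacetime \<Longrightarrow>
       (\<phi> has_derivative (\<lambda>v. (space_grad \<phi> w, time_deriv \<phi> w) \<bullet> v)) (at w)"
    and H: "((\<lambda>w. (space_grad \<phi> w, time_deriv \<phi> w)) has_derivative H) (at z)"
    and X: "\<And>x y. (x, 0) \<bullet> H (y, 0) = x \<bullet> (space_hess \<phi> z *v y)"
    by (rule smooth_spacetime_gradient[OF assms(1,2)]) blast
  define h where "h = onorm H"
  have bl: "bounded_linear H" using H by (rule has_derivative_bounded_linear)
  have h0: "0 \<le> h" unfolding h_def by (rule onorm_pos_le[OF bl])
  have hH: "v \<bullet> H w \<le> h * (norm v * norm w)" for v w
  proof -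
    have "v \<bullet> H w \<le> norm v * norm (H w)" by (rule norm_cauchy_schwarz)
    also have "\<dots> \<le> norm v * (h * norm w)"
      unfolding h_def by (intro mult_left_mono onorm bl) auto
    finally show ?thesis by (simp add: algebra_simps)
  qed
  obtain r where r: "r > 0" "\<And>v. norm v < r \<Longrightarrow>
     \<bar>\<phi> (z + v) - \<phi> z - (space_grad \<phi> z, time_deriv \<phi> z) \<bullet> v - (v \<bullet> H v) / 2\<bar> \<le> \<epsilon>/2 * (norm v)\<^sup>2"
    using second_order_expansion[OF spacetime_open assms(2) G H, of "\<epsilon>/2"] assms(3) by auto
  define C where "C = h\<^sup>2 / (4 * (\<epsilon>/2)) + h/2 + \<epsilon>/2"
  have C: "C > 0" using h0 assms(3) by (simp add: C_def add_nonneg_pos)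
  show thesis
  proof (rule that[OF C r(1)])
    fix y :: "real^'n" and s :: real
    assume ys: "norm (y, s) < r"
    define n where "n = e \<bullet> y"
    define x where "x = y - n *\<^sub>R e"
    define v where "v = (y, s)"
    define \<rho> where "\<rho> = (n *\<^sub>R e, s)"
    have v: "v = (x, 0) + \<rho>" by (simp add: v_def x_def \<rho>_def)
    define S where "S = n\<^sup>2 + s\<^sup>2"
    define k where "k = h\<^sup>2 / (4 * (\<epsilon>/2))"
    have ee: "e \<bullet> e = 1" using assms(4) by (simp add: norm_eq_1)
    have \<rho>: "(norm \<rho>)\<^sup>2 = n\<^sup>2 + s\<^sup>2"
      unfolding power2_norm_eq_inner by (simp add: \<rho>_def ee power2_eq_square)
    have vv: "(norm v)\<^sup>2 = (norm x)\<^sup>2 + (n\<^sup>2 + s\<^sup>2)"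
      unfolding power2_norm_eq_inner
      by (simp add: v_def x_def inner_diff_left inner_diff_right ee
          inner_commute[of y e] n_def[symmetric] power2_eq_square)
    have "v \<bullet> H v = (x, 0) \<bullet> H (x, 0) + (x, 0) \<bullet> H \<rho> + \<rho> \<bullet> H (x, 0) + \<rho> \<bullet> H \<rho>"
      unfolding v by (simp add: linear_add[OF bounded_linear.linear[OF bl]] inner_add_left inner_add_right)
    moreover have "(x, 0) \<bullet> H \<rho> \<le> h * (norm x * norm \<rho>)" "\<rho> \<bullet> H (x, 0) \<le> h * (norm x * norm \<rho>)"
      using hH[of "(x, 0)" \<rho>] hH[of \<rho> "(x, 0)"] by (simp_all add: mult.commute)
    moreover have "\<rho> \<bullet> H \<rho> \<le> h * S"
      using hH[of \<rho> \<rho>] \<rho> by (simp add: S_def power2_eq_square)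
    moreover have "h * (norm x * norm \<rho>) \<le> \<epsilon>/2 * (norm x)\<^sup>2 + k * S"
      using young_product[of "\<epsilon>/2" h "norm x" "norm \<rho>"] assms(3) \<rho> by (simp add: S_def k_def)
    moreover have "\<epsilon>/2 * (norm v)\<^sup>2 = \<epsilon>/2 * (norm x)\<^sup>2 + \<epsilon>/2 * S"
      unfolding vv S_def by (rule distrib_left)
    moreover have "C * S = k * S + h/2 * S + \<epsilon>/2 * S"
      unfolding C_def k_def by (simp only: distrib_right)
    ultimately have "(v \<bullet> H v) / 2 + \<epsilon>/2 * (norm v)\<^sup>2 \<le>
        half_form (space_hess \<phi> z) x + \<epsilon> * (norm x)\<^sup>2 + C * S"
      unfolding half_form_def X[symmetric] by linarith
    moreover have "\<bar>\<phi> (z + v) - \<phi> z - (space_grad \<phi> z, time_deriv \<phi> z) \<bullet> v - (v \<bullet> H v) / 2\<bar>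
        \<le> \<epsilon>/2 * (norm v)\<^sup>2"
      using r(2)[of v] ys unfolding v_def by blast
    ultimately have "\<phi> (z + v) \<le> \<phi> z + (space_grad \<phi> z, time_deriv \<phi> z) \<bullet> v +
        half_form (space_hess \<phi> z) x + \<epsilon> * (norm x)\<^sup>2 + C * S"
      by linarith
    then show "\<phi> (z + (y, s)) \<le> \<phi> z + space_grad \<phi> z \<bullet> y + time_deriv \<phi> z * s +
       half_form (space_hess \<phi> z) (y - (e \<bullet> y) *\<^sub>R e) + \<epsilon> * (norm (y - (e \<bullet> y) *\<^sub>R e))\<^sup>2 +
       C * ((e \<bullet> y)\<^sup>2 + s\<^sup>2)"
      by (simp add: v_def x_def n_def S_def)
  qed
qed

text \<open>With \<open>P\<close> the projection orthogonal to \<open>p\<close> and \<open>S\<close> the symmetric part of \<open>X\<close>, take \<open>Y = P S P + \<epsilon> P\<close>.\<close>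

lemma tangential_form_exists:
  fixes X :: "real^'n^'n" and p :: "real^'n" and \<epsilon> :: real
  assumes "p \<noteq> 0" "\<epsilon> > 0"
  obtains Y where "transpose Y = Y" "\<And>x. (Y *v x) \<bullet> p = 0"
    "trace Y \<le> trace (tangential_part p X) + \<epsilon> * CARD('n)"
    "\<And>y. half_form Y y = half_form X (y - (sgn p \<bullet> y) *\<^sub>R sgn p) + \<epsilon>/2 * (norm (y - (sgn p \<bullet> y) *\<^sub>R sgn p))\<^sup>2"
proof -
  define e where "e = sgn p"
  have ee: "e \<bullet> e = 1" using assms(1) by (simp add: e_def norm_sgn flip: norm_eq_1)
  define P where "P = mat 1 - tensor_vec e e"
  define S where "S = (1/2) *\<^sub>R (X + transpose X)"
  define Y where "Y = P ** (S ** P) + \<epsilon> *\<^sub>R P"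
  have Pv: "P *v y = y - (e \<bullet> y) *\<^sub>R e" for y
    by (simp add: P_def matrix_vector_mult_diff_rdistrib tensor_vec_mult)
  have Pt: "transpose P = P"
    by (simp add: P_def transpose_def tensor_vec_def vec_eq_iff mat_def mult.commute)
  have St: "transpose S = S"
    by (simp add: S_def transpose_def vec_eq_iff add.commute)
  have PP: "P ** P = P"
    by (simp add: matrix_eq matrix_vector_mul_assoc[symmetric] Pv inner_diff_right ee)
  have P_sym: "x \<bullet> (P *v y) = y \<bullet> (P *v x)" for x y by (rule symmetric_form[OF Pt])
  have Yv: "Y *v y = P *v (S *v (P *v y)) + \<epsilon> *\<^sub>R (P *v y)" for y
    by (simp add: Y_def matrix_vector_mult_add_rdistrib matrix_vector_mul_assoc[symmetric] scaleR_matrix_vector_assoc)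
  have "transpose Y = Y"
  proof -
    have "transpose Y = transpose (P ** (S ** P)) + \<epsilon> *\<^sub>R transpose P"
      by (simp add: Y_def transpose_def vec_eq_iff)
    then show ?thesis
      by (simp add: Y_def matrix_transpose_mul Pt St matrix_mul_assoc)
  qed
  moreover have "(Y *v x) \<bullet> p = 0" for x
  proof -
    have "P *v p = 0" using sgn_inner_self[of p] by (simp add: Pv e_def)
    then have "(P *v w) \<bullet> p = 0" for w using P_sym[of p w] by (simp add: inner_commute)
    then show ?thesis by (simp add: Yv inner_add_left)
  qed
  moreover have "trace Y \<le> trace (tangential_part p X) + \<epsilon> * CARD('n)"
  proof -
    have "trace (P ** (S ** P)) = trace (P ** S)"
      by (metis PP matrix_mul_assoc trace_mul_sym)
    also have "\<dots> = (trace (P ** X) + trace (P ** transpose X)) / 2"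
      by (simp add: S_def matrix_scaleR_right matrix_add_ldistrib trace_add[symmetric])
        (simp add: trace_def flip: sum_divide_distrib)
    also have "trace (P ** transpose X) = trace (P ** X)"
    proof -
      have "trace (transpose A) = trace A" for A :: "real^'n^'n" by (simp add: trace_def transpose_def)
      then have "trace (P ** transpose X) = trace (transpose (P ** transpose X))" by simp
      also have "\<dots> = trace (X ** P)" by (simp add: matrix_transpose_mul Pt)
      also have "\<dots> = trace (P ** X)" by (rule trace_mul_sym)
      finally show ?thesis .
    qed
    finally have "trace (P ** (S ** P)) = trace (tangential_part p X)"
      by (simp add: tangential_part_def P_def e_def)
    moreover have "trace P \<le> CARD('n)"
      by (simp add: P_def trace_sub trace_I) (simp add: trace_def tensor_vec_def sum_nonneg)
    then have "trace (\<epsilon> *\<^sub>R P) \<le> \<epsilon> * CARD('n)"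
      using assms(2) by (simp add: trace_def flip: sum_distrib_left)
    ultimately show ?thesis by (simp add: Y_def trace_add)
  qed
  moreover have "half_form Y y = half_form X (y - (e \<bullet> y) *\<^sub>R e) + \<epsilon>/2 * (norm (y - (e \<bullet> y) *\<^sub>R e))\<^sup>2" for y
  proof -
    have tX: "w \<bullet> (w v* X) = w \<bullet> (X *v w)" for w
      by (metis dot_lmul_matrix inner_commute)
    have "w \<bullet> (S *v w) = w \<bullet> (X *v w)" for w
      by (simp add: S_def scaleR_matrix_vector_assoc[symmetric] matrix_vector_mult_add_rdistrib inner_add_right tX)
    moreover have move: "y \<bullet> (P *v w) = (P *v y) \<bullet> w" for w using P_sym[of y w] by (simp add: inner_commute)
    moreover have "y \<bullet> (P *v y) = (P *v y) \<bullet> (P *v y)"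
      using move[of "P *v y"] by (simp add: matrix_vector_mul_assoc PP)
    ultimately have "y \<bullet> (Y *v y) = (P *v y) \<bullet> (X *v (P *v y)) + \<epsilon> * (norm (P *v y))\<^sup>2"
      by (simp only: Yv inner_add_right inner_scaleR_right power2_norm_eq_inner)
    then show ?thesis by (simp add: half_form_def Pv)
  qed
  ultimately show thesis using that unfolding e_def by blast
qed

lemma square_sum4_le: "(a + b + c + d)\<^sup>2 \<le> 4 * (a\<^sup>2 + b\<^sup>2 + c\<^sup>2 + d\<^sup>2)" for a b c d :: real
proof -
  have "0 \<le> (a - b)\<^sup>2 + (a - c)\<^sup>2 + (a - d)\<^sup>2 + (b - c)\<^sup>2 + (b - d)\<^sup>2 + (c - d)\<^sup>2" by simp
  then show ?thesis by (simp add: power2_eq_square algebra_simps)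
qed

text \<open>The squares of the normal component \<open>n\<close> and of the time component in \<open>tangential_expansion\<close> are bounded
  by \<open>C A\<^sup>2\<close> and \<open>D s\<^sup>2\<close>: solving the definition of \<open>A\<close> for \<open>|p| n\<close> expresses \<open>n\<close> by \<open>A\<close>, terms of first and second order in \<open>s\<close>,
  and a quadratic term in the tangential variable, whose square is of fourth order and is swallowed by the \<open>\<epsilon>\<close>
  part of \<open>Y\<close>. Using \<open>A\<^sup>2\<close> instead of \<open>n\<^sup>2\<close> keeps the gradient of the majorant parallel to that of \<open>A\<close>.\<close>

lemma paraboloid_majorant:
  fixes \<phi> :: "(real^'n) \<times> real \<Rightarrow> real"
  assumes "smooth_fun_on spacetime \<phi>" "z \<in> spacetime" "\<eta> > 0" and p: "p \<noteq> 0" "p = space_grad \<phi> z"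
  obtains Y C D R where "transpose Y = Y" "\<And>x. (Y *v x) \<bullet> p = 0"
    "trace Y \<le> trace (tangential_part p (space_hess \<phi> z)) + \<eta>" "C > 0" "R > 0"
    "\<And>w. w \<in> ball z R \<Longrightarrow> \<phi> w \<le> \<phi> z + paraboloid z 0 p Y (time_deriv \<phi> z) D w
       + C * (paraboloid z 0 p Y (time_deriv \<phi> z) D w)\<^sup>2"
proof -
  define \<epsilon> where "\<epsilon> = \<eta> / CARD('n)"
  have \<epsilon>: "\<epsilon> > 0" using assms(3) by (simp add: \<epsilon>_def)
  define e where "e = sgn p"
  define b where "b = time_deriv \<phi> z"
  have e1: "norm e = 1" using p(1) by (simp add: e_def norm_sgn)
  obtain Y where Y: "transpose Y = Y" "\<And>x. (Y *v x) \<bullet> p = 0"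
    "trace Y \<le> trace (tangential_part p (space_hess \<phi> z)) + \<epsilon> * CARD('n)"
    "\<And>y. half_form Y y = half_form (space_hess \<phi> z) (y - (e \<bullet> y) *\<^sub>R e) + \<epsilon>/2 * (norm (y - (e \<bullet> y) *\<^sub>R e))\<^sup>2"
    unfolding e_def by (rule tangential_form_exists[OF p(1) \<epsilon>, of "space_hess \<phi> z"]) blast
  obtain K r where K: "K > 0" "r > 0" and exp:
    "\<And>y s. norm (y, s) < r \<Longrightarrow> \<phi> (z + (y, s)) \<le> \<phi> z + p \<bullet> y + b * s +
       half_form (space_hess \<phi> z) (y - (e \<bullet> y) *\<^sub>R e) + \<epsilon>/4 * (norm (y - (e \<bullet> y) *\<^sub>R e))\<^sup>2 +
       K * ((e \<bullet> y)\<^sup>2 + s\<^sup>2)"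
  proof -
    have "\<epsilon>/4 > 0" using \<epsilon> by simp
    from tangential_expansion[OF assms(1,2) this e1] show thesis
      using that unfolding p(2) b_def by blast
  qed
  define k where "k = onorm ((*v) Y)"
  \<comment> \<open>the factor 4 is the constant of \<open>square_sum4_le\<close>\<close>
  define C where "C = 4 * K / (norm p)\<^sup>2"
  \<comment> \<open>the summand 1 pays for the term of fourth order in time\<close>
  define D where "D = K + C * b\<^sup>2 + 1"
  have C: "C > 0" using K p(1) by (simp add: C_def)
  define R where "R = min r (min (sqrt (\<epsilon> / (4 * (C * k\<^sup>2 + 1)))) (sqrt (1 / (C * D\<^sup>2 + 1))))"
  have pos: "0 < C * k\<^sup>2 + 1" "0 < C * D\<^sup>2 + 1" using C by (simp_all add: add_nonneg_pos)
  have R: "R > 0" using K \<epsilon> pos by (simp add: R_def)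
  have main: "\<phi> (z + (y, s)) \<le> \<phi> z + A + C * A\<^sup>2"
    if ys: "norm (y, s) < R" and A: "A = p \<bullet> y + half_form Y y + b * s + D * s\<^sup>2" for y s A
  proof -
    define n where "n = e \<bullet> y"
    define x where "x = y - n *\<^sub>R e"
    define W where "W = half_form Y y"
    have py: "p \<bullet> y = norm p * n"
      using p(1) by (simp add: n_def e_def sgn_div_norm)
    have "norm x \<le> norm y"
    proof -
      have "(norm x)\<^sup>2 = (norm y)\<^sup>2 - n\<^sup>2"
        using e1 unfolding power2_norm_eq_inner
        by (simp add: x_def inner_diff_left inner_diff_right norm_eq_1
            n_def inner_commute[of y e] power2_eq_square)
      then show ?thesis by (intro power2_le_imp_le[of "norm x" "norm y"]) simp_all
    qed
    also have "norm y \<le> norm (y, s)" using norm_fst_le[of y s] by simp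
    finally have nx: "norm x < R" using ys by simp
    have "\<bar>s\<bar> \<le> norm (y, s)" using norm_snd_le[of s y] by simp
    then have ns: "\<bar>s\<bar> < R" using ys by simp
    have x2: "C * k\<^sup>2 * (norm x)\<^sup>2 \<le> \<epsilon> / 4"
    proof -
      have "norm x \<le> sqrt (\<epsilon> / (4 * (C * k\<^sup>2 + 1)))" using nx by (simp add: R_def)
      then have "(norm x)\<^sup>2 \<le> \<epsilon> / (4 * (C * k\<^sup>2 + 1))"
        using \<epsilon> pos by (metis abs_norm_cancel real_le_rsqrt real_sqrt_abs real_sqrt_le_iff)
      then have "(C * k\<^sup>2 + 1) * (norm x)\<^sup>2 \<le> \<epsilon> / 4"
        using pos by (simp add: field_simps)
      moreover have "C * k\<^sup>2 * (norm x)\<^sup>2 \<le> (C * k\<^sup>2 + 1) * (norm x)\<^sup>2"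
        by (intro mult_right_mono) auto
      ultimately show ?thesis by linarith
    qed
    have s2: "C * D\<^sup>2 * s\<^sup>2 \<le> 1"
    proof -
      have "\<bar>s\<bar> \<le> sqrt (1 / (C * D\<^sup>2 + 1))" using ns by (simp add: R_def)
      then have "s\<^sup>2 \<le> 1 / (C * D\<^sup>2 + 1)"
        by (metis real_sqrt_abs real_sqrt_le_iff)
      then have "(C * D\<^sup>2 + 1) * s\<^sup>2 \<le> 1"
        using pos by (simp add: field_simps)
      moreover have "C * D\<^sup>2 * s\<^sup>2 \<le> (C * D\<^sup>2 + 1) * s\<^sup>2"
        by (intro mult_right_mono) auto
      ultimately show ?thesis by linarith
    qed
    have WY: "half_form (space_hess \<phi> z) x + \<epsilon>/2 * (norm x)\<^sup>2 = W"
      using Y(4)[of y] by (simp add: W_def x_def n_def)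
    have "W = half_form Y x"
    proof -
      have "e \<bullet> x = 0"
        using e1 by (simp add: x_def n_def inner_diff_right norm_eq_1)
      then show ?thesis using Y(4)[of x] WY by simp
    qed
    then have "\<bar>W\<bar> \<le> k * (norm x)\<^sup>2" unfolding k_def by (simp add: abs_half_form_le)
    then have "\<bar>W\<bar>\<^sup>2 \<le> (k * (norm x)\<^sup>2)\<^sup>2" by (intro power_mono) auto
    then have "C * W\<^sup>2 \<le> C * ((k * (norm x)\<^sup>2)\<^sup>2)" using C by simp
    also have "\<dots> = (C * k\<^sup>2 * (norm x)\<^sup>2) * (norm x)\<^sup>2"
      by (simp add: power2_eq_square mult_ac)
    also have "\<dots> \<le> \<epsilon>/4 * (norm x)\<^sup>2" using x2 by (intro mult_right_mono) auto
    finally have CW: "C * W\<^sup>2 \<le> \<epsilon>/4 * (norm x)\<^sup>2" .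
    have "C * (D * s\<^sup>2)\<^sup>2 = (C * D\<^sup>2 * s\<^sup>2) * s\<^sup>2" by (simp add: power2_eq_square mult_ac)
    also have "\<dots> \<le> 1 * s\<^sup>2" using s2 by (intro mult_right_mono) auto
    finally have CD: "C * (D * s\<^sup>2)\<^sup>2 \<le> s\<^sup>2" by simp
    have "(norm p * n)\<^sup>2 = (A + (- W) + (- (b * s)) + (- (D * s\<^sup>2)))\<^sup>2"
      by (simp add: A py W_def)
    also have "\<dots> \<le> 4 * (A\<^sup>2 + (- W)\<^sup>2 + (- (b * s))\<^sup>2 + (- (D * s\<^sup>2))\<^sup>2)"
      by (rule square_sum4_le)
    finally have "(norm p * n)\<^sup>2 / 4 \<le> A\<^sup>2 + W\<^sup>2 + (b * s)\<^sup>2 + (D * s\<^sup>2)\<^sup>2" by simp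
    then have "C * ((norm p * n)\<^sup>2 / 4) \<le> C * (A\<^sup>2 + W\<^sup>2 + (b * s)\<^sup>2 + (D * s\<^sup>2)\<^sup>2)"
      using C by (intro mult_left_mono) simp_all
    moreover have "C * ((norm p * n)\<^sup>2 / 4) = K * n\<^sup>2"
      using p(1) by (simp add: C_def power_mult_distrib)
    ultimately have "K * n\<^sup>2 \<le> C * (A\<^sup>2 + W\<^sup>2 + (b * s)\<^sup>2 + (D * s\<^sup>2)\<^sup>2)" by simp
    with CW CD have Kn: "K * n\<^sup>2 \<le> C * A\<^sup>2 + \<epsilon>/4 * (norm x)\<^sup>2 + C * b\<^sup>2 * s\<^sup>2 + s\<^sup>2"
      by (simp add: distrib_left power_mult_distrib mult_ac)
    have "norm (y, s) < r" using ys by (simp add: R_def)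
    from exp[OF this] have "\<phi> (z + (y, s)) \<le> \<phi> z + p \<bullet> y + b * s + (W - \<epsilon>/4 * (norm x)\<^sup>2) + K * n\<^sup>2 + K * s\<^sup>2"
      using WY by (simp add: x_def n_def algebra_simps)
    also have "\<dots> \<le> \<phi> z + A + C * A\<^sup>2"
      using Kn by (simp add: A W_def D_def algebra_simps)
    finally show ?thesis .
  qed
  show thesis
  proof (rule that[OF Y(1,2) _ C R])
    show "trace Y \<le> trace (tangential_part p (space_hess \<phi> z)) + \<eta>"
      using Y(3) by (simp add: \<epsilon>_def)
    fix w assume w: "w \<in> ball z R"
    obtain y s where ys: "w - z = (y, s)" by (meson surj_pair)
    then have w': "w = z + (y, s)" by (simp add: algebra_simps)
    have "norm (y, s) < R" using w by (simp flip: ys add: dist_norm norm_minus_commute)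
    show "\<phi> w \<le> \<phi> z + paraboloid z 0 p Y (time_deriv \<phi> z) D w
       + C * (paraboloid z 0 p Y (time_deriv \<phi> z) D w)\<^sup>2"
      unfolding w' by (rule main) (use \<open>norm (y, s) < R\<close> in \<open>simp_all add: paraboloid_def b_def\<close>)
  qed
qed

section \<open>The effective mobility\<close>

lemma eff_mobility_nonneg:
  assumes "admissible_mobility m"
  shows "0 \<le> eff_mobility m q e"
proof -
  have "bdd_below (range (\<lambda>(y, v). m y v))" "0 < Inf (range (\<lambda>(y, v). m y v))"
    using assms by (auto simp: admissible_mobility_def intro: bounded_imp_bdd_below)
  then have "0 \<le> m y v" for y v
    using cInf_lower[of "m y v" "range (\<lambda>(y, v). m y v)"] by force
  then show ?thesis
    unfolding eff_mobility_def wave_const_def set_lebesgue_integral_def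
    by (intro mult_nonneg_nonneg) (auto intro!: integral_nonneg_AE)
qed

text \<open>Dominated convergence with majorant a multiple of \<open>(deriv q)\<^sup>2\<close> over one period cell. Since \<open>m\<close> lies between
  two positive constants, the integrand and this majorant are integrable or not simultaneously for all directions; if they
  are not, every integral has the default value 0 and the effective mobility is constant.\<close>

lemma continuous_eff_mobility:
  fixes m :: "real^'n \<Rightarrow> real^'n \<Rightarrow> real"
  assumes m: "admissible_mobility m" and q: "continuous_on UNIV (deriv q)"
  shows "continuous_on S (eff_mobility m q)"
proof -
  define A :: "(real \<times> (real^'n)) set" where "A = UNIV \<times> cbox 0 1"
  define g where "g e z = m (snd z) (deriv q (fst z) *\<^sub>R e)" for e and z :: "real \<times> (real^'n)"
  define w where "w z = indicator A z * (deriv q (fst z))\<^sup>2" for z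
  define I where "I e = (LINT z|lborel. g e z * w z)" for e
  have mcont: "continuous_on UNIV (\<lambda>(y, v). m y v)"
    and "bounded (range (\<lambda>(y, v). m y v))" and Inf: "0 < Inf (range (\<lambda>(y, v). m y v))"
    using m by (auto simp: admissible_mobility_def)
  define \<theta> where "\<theta> = Inf (range (\<lambda>(y, v). m y v))"
  obtain B where B: "\<bar>m y v\<bar> \<le> B" for y v
    using \<open>bounded (range (\<lambda>(y, v). m y v))\<close> by (auto simp: bounded_iff)
  have \<theta>: "0 < \<theta>" "\<theta> \<le> m y v" for y v
    using cInf_lower[of "m y v" "range (\<lambda>(y, v). m y v)"]
      bounded_imp_bdd_below[OF \<open>bounded (range (\<lambda>(y, v). m y v))\<close>] Inf
    by (force simp: \<theta>_def)+
  have dq: "continuous_on T (\<lambda>z. deriv q (f z))" if "continuous_on T f" for T :: "'b::topological_space set" and f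
    using continuous_on_compose2[OF q that] by simp
  have gcont: "continuous_on T (\<lambda>y. g (fst y) (snd y))" for T
  proof -
    have "continuous_on T (\<lambda>y. (snd (snd y), deriv q (fst (snd y)) *\<^sub>R fst y))"
      by (intro continuous_intros dq)
    from continuous_on_compose2[OF mcont this] show ?thesis by (simp add: g_def)
  qed
  have meas_g: "g e \<in> borel_measurable lborel" for e
  proof -
    have "continuous_on UNIV (\<lambda>z. g (fst (e, z)) (snd (e, z)))"
      by (rule continuous_on_compose2[OF gcont[of UNIV]]) (auto intro!: continuous_intros)
    then show ?thesis by (simp add: borel_measurable_continuous_onI)
  qed
  have meas_w: "w \<in> borel_measurable lborel"
  proof -
    have "closed A" by (auto simp: A_def intro: closed_Times)
    then have "A \<in> sets lborel" by (simp add: borel_closed)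
    moreover have "(\<lambda>z. (deriv q (fst z))\<^sup>2) \<in> borel_measurable (lborel :: (real \<times> (real^'n)) measure)"
      by (simp, intro borel_measurable_continuous_onI continuous_intros dq)
    ultimately show ?thesis unfolding w_def [abs_def] by measurable
  qed
  have w0: "0 \<le> w z" for z by (simp add: w_def)
  have "continuous_on UNIV I"
  proof (cases "integrable lborel w")
    case True
    show ?thesis
    proof (rule continuous_on_sequentiallyI)
      fix X :: "nat \<Rightarrow> real^'n" and e assume "X \<longlonglongrightarrow> e"
      show "(\<lambda>n. I (X n)) \<longlonglongrightarrow> I e"
        unfolding I_def
      proof (rule integral_dominated_convergence[where w = "\<lambda>z. B * w z"])
        show "AE z in lborel. (\<lambda>n. g (X n) z * w z) \<longlonglongrightarrow> g e z * w z"
        proof (intro AE_I2 tendsto_mult tendsto_const)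
          fix z :: "real \<times> (real^'n)"
          have "(\<lambda>n. (X n, z)) \<longlonglongrightarrow> (e, z)" by (intro tendsto_intros \<open>X \<longlonglongrightarrow> e\<close>)
          with continuous_on_tendsto_compose[OF gcont[of UNIV] this]
          show "(\<lambda>n. g (X n) z) \<longlonglongrightarrow> g e z" by simp
        qed
        show "AE z in lborel. norm (g (X n) z * w z) \<le> B * w z" for n
          using B w0 by (intro AE_I2) (auto simp: g_def abs_mult intro!: mult_right_mono)
      qed (use True meas_g meas_w in auto)
    qed
  next
    case False
    have "\<not> integrable lborel (\<lambda>z. g e z * w z)" for e
    proof
      assume "integrable lborel (\<lambda>z. g e z * w z)"
      then have "integrable lborel (\<lambda>z. inverse \<theta> * (g e z * w z))" by simp
      then have "integrable lborel w"
      proof (rule Bochner_Integration.integrable_bound)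
        have "\<theta> * w z \<le> g e z * w z" for z
          using \<theta>(2) w0 by (intro mult_right_mono) (auto simp: g_def)
        then have "w z \<le> inverse \<theta> * (g e z * w z)" for z
          using \<theta>(1) by (simp add: field_simps)
        then show "AE z in lborel. norm (w z) \<le> norm (inverse \<theta> * (g e z * w z))"
          using w0 by (intro AE_I2) (smt (verit) real_norm_def)
      qed (rule meas_w)
      with False show False by simp
    qed
    then have "I e = 0" for e by (simp add: I_def not_integrable_integral_eq)
    then show ?thesis by (simp add: I_def [abs_def] continuous_on_const)
  qed
  moreover have "eff_mobility m q e = inverse (wave_const q) * I e" for e
    by (simp add: eff_mobility_def I_def g_def w_def A_def set_lebesgue_integral_def mult_ac)
  ultimately show ?thesis
    by (simp add: continuous_on_mult_left continuous_on_subset[OF _ subset_UNIV])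
qed

section \<open>Subsolutions and supersolutions\<close>

lemma viscosity_subsolution_of_irrational:
  fixes u :: "(real^'n) \<times> real \<Rightarrow> real"
  assumes U: "open U" "U \<subseteq> spacetime"
    and \<mu>: "continuous_on (sphere 0 1) \<mu>" "\<And>e. 0 \<le> \<mu> e"
    and sub: "irrational_subsolution \<mu> U u"
  shows "viscosity_subsolution \<mu> U u"
proof -
  have "mcf_operator \<mu> \<phi> z \<le> 0"
    if z: "z \<in> U" and smooth: "smooth_fun_on spacetime \<phi>"
      and max: "strict_local_max_on spacetime (\<lambda>w. u w - \<phi> w) z"
      and grad: "space_grad \<phi> z \<noteq> 0" for \<phi> z
  proof -
    define p where "p = space_grad \<phi> z"
    have "\<mu> (sgn p) * time_deriv \<phi> z \<le> trace (tangential_part p (space_hess \<phi> z))"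
    proof (rule field_le_epsilon)
      fix \<eta> :: real assume "\<eta> > 0"
      have zs: "z \<in> spacetime" using z U by auto
      obtain Y C D R where Y: "transpose Y = Y" "\<And>x. (Y *v x) \<bullet> p = 0"
        "trace Y \<le> trace (tangential_part p (space_hess \<phi> z)) + \<eta>" and C: "C > 0" and R: "R > 0"
        and major: "\<And>w. w \<in> ball z R \<Longrightarrow> \<phi> w \<le> \<phi> z + paraboloid z 0 p Y (time_deriv \<phi> z) D w
          + C * (paraboloid z 0 p Y (time_deriv \<phi> z) D w)\<^sup>2"
        by (rule paraboloid_majorant[OF smooth zs \<open>\<eta> > 0\<close> grad[folded p_def] p_def]) blast
      obtain r where r: "r > 0" "\<And>w. w \<in> ball z r \<inter> spacetime \<Longrightarrow> w \<noteq> z \<Longrightarrow> u w - \<phi> w < u z - \<phi> z"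
        using max unfolding strict_local_max_on_def by blast
      obtain s where s: "s > 0" "ball z s \<subseteq> U" using U(1) z openE by blast
      have "\<mu> (sgn p) * time_deriv \<phi> z \<le> trace Y"
      proof (rule touching_bound[OF sub U z \<mu> Y(1,2) _ C])
        show "p \<noteq> 0" using grad by (simp add: p_def)
        show "0 < min R (min r s)" using R r s by simp
        fix w assume w: "w \<in> ball z (min R (min r s))" "w \<noteq> z"
        then have "w \<in> spacetime" using s U by auto
        with r(2)[of w] major[of w] w
        show "u w - u z < paraboloid z 0 p Y (time_deriv \<phi> z) D w
          + C * (paraboloid z 0 p Y (time_deriv \<phi> z) D w)\<^sup>2"
          by simp
      qed
      with Y(3) show "\<mu> (sgn p) * time_deriv \<phi> z \<le> trace (tangential_part p (space_hess \<phi> z)) + \<eta>"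
        by simp
    qed
    then show ?thesis by (simp add: mcf_operator_def p_def)
  qed
  then show ?thesis
    using sub unfolding viscosity_subsolution_def irrational_subsolution_def by blast
qed

lemma Ck_on_cong:
  assumes "Ck_on k S f" "open S" "\<And>x. x \<in> S \<Longrightarrow> f x = g x"
  shows "Ck_on k S g"
  using assms(1,3)
proof (induction k arbitrary: f g)
  case 0
  then show ?case using continuous_on_cong[of S S f g] by simp
next
  case (Suc k)
  have D: "(g has_derivative frechet_derivative f (at x)) (at x)" if "x \<in> S" for x
  proof (rule has_derivative_transform_within_open[OF _ \<open>open S\<close> that])
    show "(f has_derivative frechet_derivative f (at x)) (at x)"
      using Suc.prems(1) that by (simp add: frechet_derivative_works[symmetric])
  qed (use Suc.prems(2) in auto)
  have "Ck_on k S (\<lambda>x. frechet_derivative g (at x) v)" for v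
  proof (rule Suc.IH)
    show "Ck_on k S (\<lambda>x. frechet_derivative f (at x) v)" using Suc.prems(1) by simp
    show "frechet_derivative f (at x) v = frechet_derivative g (at x) v" if "x \<in> S" for x
      using frechet_derivative_at[OF D[OF that]] by simp
  qed
  then show ?case using D by (auto simp: differentiable_def)
qed

lemma frechet_derivative_uminus:
  fixes f :: "'a::real_normed_vector \<Rightarrow> real"
  assumes "f differentiable (at x)"
  shows "frechet_derivative (\<lambda>x. - f x) (at x) = (\<lambda>v. - frechet_derivative f (at x) v)"
  using frechet_derivative_at[OF has_derivative_minus[OF assms[unfolded frechet_derivative_works]]] by simp

lemma Ck_on_minus:
  assumes "Ck_on k S f" "open S"
  shows "Ck_on k S (\<lambda>x. - f x)"
  using assms(1)
proof (induction k arbitrary: f)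
  case 0
  then show ?case by (simp add: continuous_on_minus)
next
  case (Suc k)
  have diff: "f differentiable (at x)" if "x \<in> S" for x
    using Suc.prems that by simp
  have "Ck_on k S (\<lambda>x. frechet_derivative (\<lambda>x. - f x) (at x) v)" for v
  proof (rule Ck_on_cong[OF _ \<open>open S\<close>])
    show "Ck_on k S (\<lambda>x. - frechet_derivative f (at x) v)"
      using Suc.prems by (intro Suc.IH) simp
  qed (simp add: frechet_derivative_uminus diff)
  then show ?case using diff by (simp add: differentiable_minus)
qed

lemma smooth_fun_on_minus: "smooth_fun_on S f \<Longrightarrow> open S \<Longrightarrow> smooth_fun_on S (\<lambda>x. - f x)"
  by (simp add: smooth_fun_on_def Ck_on_minus)

lemma smooth_derivatives_minus:
  fixes \<phi> :: "(real^'n) \<times> real \<Rightarrow> real"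
  assumes "smooth_fun_on spacetime \<phi>" "z \<in> spacetime"
  shows "time_deriv (\<lambda>w. - \<phi> w) z = - time_deriv \<phi> z"
    and "space_grad (\<lambda>w. - \<phi> w) z = - space_grad \<phi> z"
    and "space_hess (\<lambda>w. - \<phi> w) z = - space_hess \<phi> z"
proof -
  have C2: "Ck_on (Suc (Suc 0)) spacetime \<phi>"
    using assms(1) by (simp add: smooth_fun_on_def del: Ck_on.simps)
  have d: "frechet_derivative (\<lambda>w. - \<phi> w) (at w) = (\<lambda>v. - frechet_derivative \<phi> (at w) v)"
    if "w \<in> spacetime" for w
    using C2 that by (intro frechet_derivative_uminus) simp
  show "time_deriv (\<lambda>w. - \<phi> w) z = - time_deriv \<phi> z"
    using assms(2) by (simp add: time_deriv_def d)
  have grad: "space_grad (\<lambda>w. - \<phi> w) w = - space_grad \<phi> w" if "w \<in> spacetime" for w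
    using that by (simp add: space_grad_def d vec_eq_iff)
  then show "space_grad (\<lambda>w. - \<phi> w) z = - space_grad \<phi> z" using assms(2) by simp
  have "frechet_derivative (\<lambda>w. space_grad (\<lambda>w. - \<phi> w) w $ i) (at z) v =
      - frechet_derivative (\<lambda>w. space_grad \<phi> w $ i) (at z) v" for i v
  proof -
    have diff: "(\<lambda>w. space_grad \<phi> w $ i) differentiable (at z)"
      using C2 assms(2) by (simp add: space_grad_def del: split_paired_All)
    have "((\<lambda>w. space_grad \<phi> w $ i) has_derivative frechet_derivative (\<lambda>w. space_grad \<phi> w $ i) (at z)) (at z)"
      using diff by (simp add: frechet_derivative_works)
    then have "((\<lambda>w. - (space_grad \<phi> w $ i)) has_derivative
        (\<lambda>v. - frechet_derivative (\<lambda>w. space_grad \<phi> w $ i) (at z) v)) (at z)"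
      by (rule has_derivative_minus)
    then have "((\<lambda>w. space_grad (\<lambda>w. - \<phi> w) w $ i) has_derivative
        (\<lambda>v. - frechet_derivative (\<lambda>w. space_grad \<phi> w $ i) (at z) v)) (at z)"
      by (rule has_derivative_transform_within_open[OF _ spacetime_open assms(2)]) (simp add: grad)
    from frechet_derivative_at[OF this, symmetric] show ?thesis by simp
  qed
  then show "space_hess (\<lambda>w. - \<phi> w) z = - space_hess \<phi> z"
    by (simp add: space_hess_def vec_eq_iff)
qed

lemma uminus_rational_directions_iff:
  "- q \<in> rational_directions \<longleftrightarrow> q \<in> rational_directions"
  using scaleR_rational_directions_iff[of "-1" q] by simp

lemma tangential_part_minus: "tangential_part (- p) (- X) = - tangential_part p X"
proof -
  have *: "A ** (- X) = - (A ** X)" for A :: "real^'a^'a"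
    using matrix_scaleR_right[of A "-1" X] by simp
  have "tensor_vec (sgn (- p)) (sgn (- p)) = tensor_vec (sgn p) (sgn p)"
    by (simp add: tensor_vec_def sgn_minus)
  then show ?thesis by (simp add: tangential_part_def *)
qed

lemma mat_norm_minus: "mat_norm (- A) = mat_norm (A :: real^'n^'n)"
proof -
  have "(*v) (- A) = (\<lambda>x. - (A *v x))"
    by (simp add: fun_eq_iff matrix_vector_mult_def vec_eq_iff sum_negf)
  then show ?thesis by (simp add: mat_norm_def onorm_neg)
qed

lemma mcf_operator_minus:
  fixes \<phi> :: "(real^'n) \<times> real \<Rightarrow> real"
  assumes "smooth_fun_on spacetime \<phi>" "z \<in> spacetime"
  shows "mcf_operator (\<lambda>e. \<mu> (- e)) (\<lambda>w. - \<phi> w) z = - mcf_operator \<mu> \<phi> z"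
proof -
  have "trace (- A) = - trace A" for A :: "real^'n^'n" by (simp add: trace_def sum_negf)
  then show ?thesis
    by (simp only: mcf_operator_def smooth_derivatives_minus[OF assms] tangential_part_minus sgn_minus
        minus_minus mult_minus_right minus_diff_minus)
qed

lemma usc_on_minus_iff: "usc_on S (\<lambda>x. - f x) \<longleftrightarrow> lsc_on S f"
proof
  assume usc: "usc_on S (\<lambda>x. - f x)"
  show "lsc_on S f" unfolding lsc_on_def
  proof (intro ballI allI impI)
    fix x c assume "x \<in> S" "c < f x"
    then have "- f x < - c" by simp
    with usc \<open>x \<in> S\<close> have "\<forall>\<^sub>F y in at x within S. - f y < - c" unfolding usc_on_def by blast
    then show "\<forall>\<^sub>F y in at x within S. c < f y" by simp
  qed
next
  assume lsc: "lsc_on S f"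
  show "usc_on S (\<lambda>x. - f x)" unfolding usc_on_def
  proof (intro ballI allI impI)
    fix x c assume "x \<in> S" "- f x < c"
    then have "- c < f x" by simp
    with lsc \<open>x \<in> S\<close> have "\<forall>\<^sub>F y in at x within S. - c < f y" unfolding lsc_on_def by blast
    then show "\<forall>\<^sub>F y in at x within S. - f y < c" by (rule eventually_mono) simp
  qed
qed

lemma locally_bounded_on_minus_iff: "locally_bounded_on S (\<lambda>x. - f x) \<longleftrightarrow> locally_bounded_on S f"
  by (simp add: locally_bounded_on_def bounded_iff)

lemma strict_local_max_on_minus_iff:
  "strict_local_max_on S (\<lambda>w. - u w - \<phi> w) z \<longleftrightarrow> strict_local_min_on S (\<lambda>w. u w - - \<phi> w) z"
proof -
  have "- u w - \<phi> w < - u z - \<phi> z \<longleftrightarrow> u z - - \<phi> z < u w - - \<phi> w" for w by linarith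
  then show ?thesis unfolding strict_local_max_on_def strict_local_min_on_def by simp
qed

text \<open>Reflection turns a test function \<open>\<phi>\<close> into \<open>- \<phi>\<close> and reverses the direction of its gradient, hence the reflected
  mobility.\<close>

lemma irrational_subsolution_minus:
  fixes u :: "(real^'n) \<times> real \<Rightarrow> real"
  assumes "irrational_supersolution \<mu> U u" "U \<subseteq> spacetime"
  shows "irrational_subsolution (\<lambda>e. \<mu> (- e)) U (\<lambda>w. - u w)"
proof -
  obtain K where K: "K > 0" and super: "\<And>\<phi> z. z \<in> U \<Longrightarrow> smooth_fun_on spacetime \<phi> \<Longrightarrow>
      strict_local_min_on spacetime (\<lambda>w. u w - \<phi> w) z \<Longrightarrow>
        (space_grad \<phi> z \<notin> rational_directions \<longrightarrow> mcf_operator \<mu> \<phi> z \<ge> 0) \<and>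
        (\<forall>\<delta>>0. space_grad \<phi> z \<in> rational_directions - {0} \<and>
            mat_norm (tangential_part (space_grad \<phi> z) (space_hess \<phi> z))
              \<le> \<delta> * norm (space_grad \<phi> z) \<longrightarrow>
            time_deriv \<phi> z \<ge> - K * \<delta> * norm (space_grad \<phi> z)) \<and>
        (norm (space_grad \<phi> z) = 0 \<and> mat_norm (space_hess \<phi> z) = 0 \<longrightarrow> time_deriv \<phi> z \<ge> 0)"
    using assms(1) unfolding irrational_supersolution_def by blast
  show ?thesis
    unfolding irrational_subsolution_def
  proof (intro conjI exI[of _ K] allI ballI impI K; (elim conjE)?)
    show "locally_bounded_on spacetime (\<lambda>w. - u w)" "usc_on spacetime (\<lambda>w. - u w)"
      using assms(1) by (auto simp: irrational_supersolution_def usc_on_minus_iff locally_bounded_on_minus_iff)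
  next
    fix \<phi> z assume z: "z \<in> U" and smooth: "smooth_fun_on spacetime \<phi>"
      and max: "strict_local_max_on spacetime (\<lambda>w. - u w - \<phi> w) z"
    have zs: "z \<in> spacetime" using z assms(2) by auto
    note d = smooth_derivatives_minus[OF smooth zs]
    note * = super[OF z smooth_fun_on_minus[OF smooth spacetime_open] max[unfolded strict_local_max_on_minus_iff],
        unfolded d tangential_part_minus mat_norm_minus norm_minus_cancel uminus_rational_directions_iff]
    show "mcf_operator (\<lambda>e. \<mu> (- e)) \<phi> z \<le> 0" if "space_grad \<phi> z \<notin> rational_directions"
      using * that mcf_operator_minus[OF smooth zs, of "\<lambda>e. \<mu> (- e)"] by simp
    show "time_deriv \<phi> z \<le> K * \<delta> * norm (space_grad \<phi> z)"
      if "\<delta> > 0" "space_grad \<phi> z \<in> rational_directions - {0}"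
        "mat_norm (tangential_part (space_grad \<phi> z) (space_hess \<phi> z)) \<le> \<delta> * norm (space_grad \<phi> z)" for \<delta>
      using conjunct1[OF conjunct2[OF *], rule_format, of \<delta>] that
      by (auto simp: uminus_rational_directions_iff)
    show "time_deriv \<phi> z \<le> 0" if "norm (space_grad \<phi> z) = 0" "mat_norm (space_hess \<phi> z) = 0"
      using * that by simp
  qed
qed

lemma viscosity_supersolution_minus:
  fixes u :: "(real^'n) \<times> real \<Rightarrow> real"
  assumes "viscosity_subsolution (\<lambda>e. \<mu> (- e)) U (\<lambda>w. - u w)" "U \<subseteq> spacetime"
  shows "viscosity_supersolution \<mu> U u"
  unfolding viscosity_supersolution_def
proof (intro conjI allI ballI impI; (elim conjE)?)
  note sub = assms(1)[unfolded viscosity_subsolution_def]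
  show "locally_bounded_on spacetime u"
    using conjunct1[OF sub] by (simp add: locally_bounded_on_minus_iff)
  show "lsc_on spacetime u"
    using conjunct1[OF conjunct2[OF sub]] by (simp add: usc_on_minus_iff)
next
  fix \<phi> z assume z: "z \<in> U" and smooth: "smooth_fun_on spacetime \<phi>"
    and min: "strict_local_min_on spacetime (\<lambda>w. u w - \<phi> w) z"
  have zs: "z \<in> spacetime" using z assms(2) by auto
  note d = smooth_derivatives_minus[OF smooth zs]
  have "strict_local_max_on spacetime (\<lambda>w. - u w - - \<phi> w) z"
    using min strict_local_max_on_minus_iff[of spacetime u "\<lambda>w. - \<phi> w" z] by simp
  with conjunct2[OF conjunct2[OF assms(1)[unfolded viscosity_subsolution_def]]] z
    smooth_fun_on_minus[OF smooth spacetime_open]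
  have *: "(space_grad (\<lambda>w. - \<phi> w) z \<noteq> 0 \<longrightarrow> mcf_operator (\<lambda>e. \<mu> (- e)) (\<lambda>w. - \<phi> w) z \<le> 0) \<and>
     (norm (space_grad (\<lambda>w. - \<phi> w) z) = 0 \<and> mat_norm (space_hess (\<lambda>w. - \<phi> w) z) = 0 \<longrightarrow>
        time_deriv (\<lambda>w. - \<phi> w) z \<le> 0)"
    by blast
  show "0 \<le> mcf_operator \<mu> \<phi> z" if "space_grad \<phi> z \<noteq> 0"
    using * that by (simp add: d mcf_operator_minus[OF smooth zs])
  show "0 \<le> time_deriv \<phi> z" if "norm (space_grad \<phi> z) = 0" "mat_norm (space_hess \<phi> z) = 0"
    using * that by (simp add: d mat_norm_minus)
qed

theorem theorem2:
  fixes m :: "real^'n \<Rightarrow> real^'n \<Rightarrow> real"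
    and W W1 W2 W3 q :: "real \<Rightarrow> real"
    and U :: "((real^'n) \<times> real) set"
    and u :: "(real^'n) \<times> real \<Rightarrow> real"
  assumes "admissible_mobility m"
    and "double_well W W1 W2 W3"
    and "standing_wave W1 q"
    and "open U" and "U \<subseteq> spacetime"
  shows "(irrational_subsolution (eff_mobility m q) U u \<longrightarrow>
            viscosity_subsolution (eff_mobility m q) U u) \<and>
         (irrational_supersolution (eff_mobility m q) U u \<longrightarrow>
            viscosity_supersolution (eff_mobility m q) U u)"
proof (intro conjI impI)
  have "continuous_on UNIV (deriv q)"
  proof (intro continuous_at_imp_continuous_on ballI)
    fix s
    have "(deriv q has_real_derivative W1 (q s)) (at s)"
      using assms(3) unfolding standing_wave_def by blast
    then show "isCont (deriv q) s" by (rule DERIV_isCont)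
  qed
  then have cont: "continuous_on S (eff_mobility m q)" for S
    by (rule continuous_eff_mobility[OF assms(1)])
  note nonneg = eff_mobility_nonneg[OF assms(1)]
  show "viscosity_subsolution (eff_mobility m q) U u" if "irrational_subsolution (eff_mobility m q) U u"
    by (rule viscosity_subsolution_of_irrational[OF assms(4,5) cont nonneg that])
  show "viscosity_supersolution (eff_mobility m q) U u" if "irrational_supersolution (eff_mobility m q) U u"
  proof (rule viscosity_supersolution_minus[OF _ assms(5)])
    have "continuous_on (sphere 0 1) (\<lambda>e. eff_mobility m q (- e))"
      by (intro continuous_on_compose2[OF cont[of UNIV]] continuous_intros) auto
    then show "viscosity_subsolution (\<lambda>e. eff_mobility m q (- e)) U (\<lambda>w. - u w)"
      by (rule viscosity_subsolution_of_irrational[OF assms(4,5) _ nonneg irrational_subsolution_minus[OF that assms(5)]])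
  qed
qed

end
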